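(* For each group size $g\in\{3,4\}$ there exists a deterministic comparison-based algorithm for the selection problem, of the "grouping and partition" type described in the context (in each iteration the pivot is obtained by arranging elements into disjoint groups of size $g$, taking medians of the groups, possibly repeating this grouping step, and recursively selecting the median of the resulting sequence of medians), whose worst-case running time on any $n$-element input is $O(n)$.
   Context: Selection problem: given a sequence $A$ of $n$ numbers and an integer $1\le i\le n$, output the $i$th smallest element of $A$. Standard simplifying assumptions: the elements of $A$ are distinct, and floors and ceilings are ignored (all group counts are treated as exact). Running time is measured in the usual RAM model with unit-cost comparisons. A grouping-and-partition selection algorithm (a variant of the algorithm SELECT of Blum, Floyd, Pratt, Rivest and Tarjan) works iteratively: if $n$ is at most a constant, sort and answer directly; otherwise arrange the current sequence into disjoint groups of size $g$ and take the median of each group (for even $g$, the lower median, i.e. the $(g/2)$th smallest, or the upper median, i.e. the $(g/2+1)$th smallest), optionally repeat this grouping step on the sequence of medians, recursively select the median $m$ of the final sequence of medians, partition the current sequence into $A_1=\{x: x<m\}$ and $A_2=\{x:x>m\}$, and return $m$ if $|A_1|=i-1$, continue on $A_1$ with the same $i$ if $|A_1|>i-1$, and otherwise continue on $A_2$ with $i$ replaced by $i-|A_1|-1$. *)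

theory Defs
  imports Complex_Main "HOL-Library.Landau_Symbols"
begin

section \<open>A structured RAM language with unit-cost comparisons\<close>

text \<open>
  A machine state consists of natural-number registers and of a memory whose cells hold the
  elements to be selected from. Programs address memory cells through registers, and can only copy
  elements and compare two of them; programs contain no elements and do not depend on the type of
  elements.
\<close>

type_synonym vname = string

type_synonym 'a state = "(vname \<Rightarrow> nat) \<times> (nat \<Rightarrow> 'a)"

datatype aexp =
    N nat
  | V vname
  | Add aexp aexp  (infixl "\<oplus>" 65)
  | Sub aexp aexp  (infixl "\<ominus>" 65)
  | Half aexp

fun aval :: "aexp \<Rightarrow> (vname \<Rightarrow> nat) \<Rightarrow> nat" where
  "aval (N n) s = n"
| "aval (V x) s = s x"
| "aval (a \<oplus> b) s = aval a s + aval b s"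
| "aval (a \<ominus> b) s = aval a s - aval b s"
| "aval (Half a) s = aval a s div 2"

fun acost :: "aexp \<Rightarrow> nat" where
  "acost (N n) = 1"
| "acost (V x) = 1"
| "acost (a \<oplus> b) = acost a + acost b + 1"
| "acost (a \<ominus> b) = acost a + acost b + 1"
| "acost (Half a) = acost a + 1"

text \<open>
  \<open>Less\<close> and \<open>Equal\<close> compare register values, whereas \<open>Elem_Less a b\<close> compares the elements
  in the memory cells with the addresses \<open>a\<close> and \<open>b\<close>.
\<close>

datatype bexp =
    Less aexp aexp
  | Equal aexp aexp
  | Elem_Less aexp aexp
  | Conj bexp bexp

fun bval :: "bexp \<Rightarrow> 'a::linorder state \<Rightarrow> bool" where
  "bval (Less a b) (s, M) \<longleftrightarrow> aval a s < aval b s"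
| "bval (Equal a b) (s, M) \<longleftrightarrow> aval a s = aval b s"
| "bval (Elem_Less a b) (s, M) \<longleftrightarrow> M (aval a s) < M (aval b s)"
| "bval (Conj p q) \<sigma> \<longleftrightarrow> bval p \<sigma> \<and> bval q \<sigma>"

fun bcost :: "bexp \<Rightarrow> nat" where
  "bcost (Less a b) = acost a + acost b + 1"
| "bcost (Equal a b) = acost a + acost b + 1"
| "bcost (Elem_Less a b) = acost a + acost b + 1"
| "bcost (Conj p q) = bcost p + bcost q + 1"

text \<open>
  \<open>Move a b\<close> copies the element in cell \<open>b\<close> to cell \<open>a\<close>. \<open>Call x args\<close> is a recursive call of the
  (single) procedure under consideration.
\<close>

datatype com =
    SKIP
  | Assign vname aexp  ("(_ ::= _)" [1000, 61] 61)
  | Move aexp aexp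
  | Seq com com  (infixr ";;" 60)
  | If bexp com com  ("(IF _/ THEN _/ ELSE _)" [0, 0, 61] 61)
  | While bexp com  ("(WHILE _/ DO _)" [0, 61] 61)
  | Call vname "(vname \<times> aexp) list"

definition frame :: "(vname \<times> nat) list \<Rightarrow> vname \<Rightarrow> nat" where
  "frame bs = (\<lambda>x. case map_of bs x of None \<Rightarrow> 0 | Some v \<Rightarrow> v)"

text \<open>
  \<open>P \<turnstile> (c, \<sigma>) \<Rightarrow>[t] \<sigma>'\<close>: started in \<open>\<sigma>\<close>, the command \<open>c\<close> halts after \<open>t\<close> unit-cost steps in
  \<open>\<sigma>'\<close>, where \<open>P\<close> is the procedure body executed by calls. Each call has its own register frame
  (so initialising it takes constant time for a fixed body), while the memory is shared; the value
  returned by a call is that of the register \<open>r\<close> of the callee.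
\<close>

inductive exec :: "com \<Rightarrow> com \<Rightarrow> 'a::linorder state \<Rightarrow> nat \<Rightarrow> 'a state \<Rightarrow> bool"
    ("(_ \<turnstile> '(_,/ _') \<Rightarrow>[_]/ _)" [60, 0, 0, 0, 60] 55)
  for P :: com
where
  Skip: "P \<turnstile> (SKIP, \<sigma>) \<Rightarrow>[1] \<sigma>"
| Assign: "P \<turnstile> (x ::= a, (s, M)) \<Rightarrow>[acost a + 1] (s(x := aval a s), M)"
| Move: "P \<turnstile> (Move a b, (s, M)) \<Rightarrow>[acost a + acost b + 1] (s, M(aval a s := M (aval b s)))"
| Seq: "P \<turnstile> (c1, \<sigma>1) \<Rightarrow>[t1] \<sigma>2 \<Longrightarrow> P \<turnstile> (c2, \<sigma>2) \<Rightarrow>[t2] \<sigma>3 \<Longrightarrow> P \<turnstile> (c1 ;; c2, \<sigma>1) \<Rightarrow>[t1 + t2] \<sigma>3"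
| IfTrue: "bval p \<sigma> \<Longrightarrow> P \<turnstile> (c1, \<sigma>) \<Rightarrow>[t] \<sigma>' \<Longrightarrow>
    P \<turnstile> (IF p THEN c1 ELSE c2, \<sigma>) \<Rightarrow>[bcost p + t + 1] \<sigma>'"
| IfFalse: "\<not> bval p \<sigma> \<Longrightarrow> P \<turnstile> (c2, \<sigma>) \<Rightarrow>[t] \<sigma>' \<Longrightarrow>
    P \<turnstile> (IF p THEN c1 ELSE c2, \<sigma>) \<Rightarrow>[bcost p + t + 1] \<sigma>'"
| WhileFalse: "\<not> bval p \<sigma> \<Longrightarrow> P \<turnstile> (WHILE p DO c, \<sigma>) \<Rightarrow>[bcost p + 1] \<sigma>"
| WhileTrue: "bval p \<sigma>1 \<Longrightarrow> P \<turnstile> (c, \<sigma>1) \<Rightarrow>[t1] \<sigma>2 \<Longrightarrow> P \<turnstile> (WHILE p DO c, \<sigma>2) \<Rightarrow>[t2] \<sigma>3 \<Longrightarrow>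
    P \<turnstile> (WHILE p DO c, \<sigma>1) \<Rightarrow>[bcost p + t1 + t2 + 1] \<sigma>3"
| Call: "P \<turnstile> (P, (frame (map (\<lambda>(y, a). (y, aval a s)) args), M)) \<Rightarrow>[t] (s', M') \<Longrightarrow>
    P \<turnstile> (Call x args, (s, M)) \<Rightarrow>[(\<Sum>(y, a)\<leftarrow>args. acost a + 1) + t + 1] (s(x := s' ''r''), M')"

inductive_cases exec_SkipE: "P \<turnstile> (SKIP, \<sigma>) \<Rightarrow>[t] \<sigma>'"
inductive_cases exec_AssignE: "P \<turnstile> (x ::= a, \<sigma>) \<Rightarrow>[t] \<sigma>'"
inductive_cases exec_MoveE: "P \<turnstile> (Move a b, \<sigma>) \<Rightarrow>[t] \<sigma>'"
inductive_cases exec_SeqE: "P \<turnstile> (c1 ;; c2, \<sigma>) \<Rightarrow>[t] \<sigma>'"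
inductive_cases exec_IfE: "P \<turnstile> (IF p THEN c1 ELSE c2, \<sigma>) \<Rightarrow>[t] \<sigma>'"
inductive_cases exec_WhileE: "P \<turnstile> (WHILE p DO c, \<sigma>) \<Rightarrow>[t] \<sigma>'"
inductive_cases exec_CallE: "P \<turnstile> (Call x args, \<sigma>) \<Rightarrow>[t] \<sigma>'"

lemma exec_deterministic:
  "P \<turnstile> (c, \<sigma>) \<Rightarrow>[t] \<sigma>' \<Longrightarrow> P \<turnstile> (c, \<sigma>) \<Rightarrow>[u] \<sigma>'' \<Longrightarrow> u = t \<and> \<sigma>'' = \<sigma>'"
proof (induction arbitrary: u \<sigma>'' rule: exec.induct)
  case Skip
  then show ?case by (auto elim: exec_SkipE)
next
  case Assign
  then show ?case by (auto elim: exec_AssignE)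
next
  case Move
  then show ?case by (auto elim: exec_MoveE)
next
  case (Seq c1 \<sigma>1 t1 \<sigma>2 c2 t2 \<sigma>3)
  from Seq.prems show ?case
  proof (rule exec_SeqE)
    fix v1 \<tau> v2
    assume "u = v1 + v2" "P \<turnstile> (c1, \<sigma>1) \<Rightarrow>[v1] \<tau>" "P \<turnstile> (c2, \<tau>) \<Rightarrow>[v2] \<sigma>''"
    then show ?thesis using Seq.IH by metis
  qed
next
  case (IfTrue p \<sigma> c1 t \<sigma>' c2)
  from IfTrue.prems IfTrue.hyps show ?case by (auto elim!: exec_IfE dest: IfTrue.IH)
next
  case (IfFalse p \<sigma> c2 t \<sigma>' c1)
  from IfFalse.prems IfFalse.hyps show ?case by (auto elim!: exec_IfE dest: IfFalse.IH)
next
  case (WhileFalse p \<sigma> c)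
  from WhileFalse.prems show ?case
    by (rule exec_WhileE) (use WhileFalse.hyps in auto)
next
  case (WhileTrue p \<sigma>1 c t1 \<sigma>2 t2 \<sigma>3)
  from WhileTrue.prems show ?case
  proof (rule exec_WhileE)
    assume "\<not> bval p \<sigma>1"
    with WhileTrue.hyps show ?thesis by simp
  next
    fix v1 \<tau> v2
    assume "u = Suc (bcost p + v1 + v2)"
      "P \<turnstile> (c, \<sigma>1) \<Rightarrow>[v1] \<tau>" "P \<turnstile> (WHILE p DO c, \<tau>) \<Rightarrow>[v2] \<sigma>''"
    then show ?thesis using WhileTrue.IH by (metis Suc_eq_plus1)
  qed
next
  case (Call s args M t s' M' x)
  from Call.prems show ?case by (auto elim!: exec_CallE dest: Call.IH)
qed


section \<open>The selection problem\<close>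

text \<open>
  The input occupies the memory cells \<open>0, \<dots>, n - 1\<close>; the other cells have arbitrary contents and
  serve as working space. The program finds \<open>n\<close>, \<open>i\<close>, the address \<open>b\<close> of the first input
  element and the address \<open>f\<close> of the first working cell in its registers, and has to return the
  address \<open>r\<close> of a cell with the \<open>i\<close>th smallest input element (where \<open>1 \<le> i \<le> n\<close>).
\<close>

definition solves_selection_in_time :: "com \<Rightarrow> (nat \<Rightarrow> nat) \<Rightarrow> bool" where
  "solves_selection_in_time P T \<longleftrightarrow>
    (\<forall>(A :: real list) (i :: nat) (M :: nat \<Rightarrow> real).
      distinct A \<longrightarrow> 1 \<le> i \<longrightarrow> i \<le> length A \<longrightarrow> (\<forall>j < length A. M j = A ! j) \<longrightarrow>
      (\<exists>t s' M'.
        P \<turnstile> (P, (frame [(''b'', 0), (''n'', length A), (''i'', i), (''f'', length A)], M)) \<Rightarrow>[t] (s', M')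
        \<and> M' (s' ''r'') = sort A ! (i - 1)
        \<and> t \<le> T (length A)))"


section \<open>Grouping-and-partition selection\<close>

text \<open>
  Insertion sort of the cells with addresses \<open>lo, \<dots>, hi - 1\<close>. In the uses below \<open>f + n\<close> is a free
  cell, and \<open>lo\<close> and \<open>hi\<close> do not mention the registers \<open>j\<close> and \<open>l\<close>.
\<close>

definition insertion_sort :: "aexp \<Rightarrow> aexp \<Rightarrow> com" where
  "insertion_sort lo hi =
    ''j'' ::= lo;;
    WHILE Less (V ''j'') hi DO (
      ''l'' ::= V ''j'';;
      WHILE Conj (Less lo (V ''l'')) (Elem_Less (V ''l'') (V ''l'' \<ominus> N 1)) DO (
        Move (V ''f'' \<oplus> V ''n'') (V ''l'');;
        Move (V ''l'') (V ''l'' \<ominus> N 1);;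
        Move (V ''l'' \<ominus> N 1) (V ''f'' \<oplus> V ''n'');;
        ''l'' ::= V ''l'' \<ominus> N 1);;
      ''j'' ::= V ''j'' \<oplus> N 1)"

datatype median = Lower | Upper

text \<open>For odd \<open>g\<close> both are the rank of the unique median.\<close>

fun median_rank :: "nat \<Rightarrow> median \<Rightarrow> nat" where
  "median_rank g Lower = (g + 1) div 2"
| "median_rank g Upper = g div 2 + 1"

text \<open>
  One grouping step on the \<open>len\<close> elements starting at address \<open>src\<close>: they are split into
  \<open>len div g\<close> groups of \<open>g\<close> consecutive elements (the last \<open>len mod g\<close> elements remain
  ungrouped), and the medians of the groups are stored from address \<open>f\<close> on, \<open>k\<close> being their
  number. The case \<open>src = f\<close> is allowed, since the medians never overtake the groups still to be
  processed.
\<close>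

definition group_medians :: "nat \<Rightarrow> median \<Rightarrow> aexp \<Rightarrow> aexp \<Rightarrow> com" where
  "group_medians g d src len =
    ''p'' ::= src;;
    ''e'' ::= src \<oplus> len;;
    ''k'' ::= N 0;;
    WHILE Less (V ''p'' \<oplus> N (g - 1)) (V ''e'') DO (
      insertion_sort (V ''p'') (V ''p'' \<oplus> N g);;
      Move (V ''f'' \<oplus> V ''k'') (V ''p'' \<oplus> N (median_rank g d - 1));;
      ''k'' ::= V ''k'' \<oplus> N 1;;
      ''p'' ::= V ''p'' \<oplus> N g)"

fun repeat_grouping :: "nat \<Rightarrow> median list \<Rightarrow> com" where
  "repeat_grouping g [] = SKIP"
| "repeat_grouping g (d # ds) = group_medians g d (V ''f'') (V ''k'');; repeat_grouping g ds"

text \<open>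
  With the pivot in cell \<open>f\<close>, copies the elements of the current sequence that are smaller than the
  pivot to the cells from \<open>f + 1\<close> on and the larger ones to the cells from \<open>f + 1 + n\<close> on; their
  numbers are \<open>c1\<close> and \<open>c2\<close>.
\<close>

definition partition_sequence :: com where
  "partition_sequence =
    ''p'' ::= V ''b'';;
    ''e'' ::= V ''b'' \<oplus> V ''n'';;
    ''c1'' ::= N 0;;
    ''c2'' ::= N 0;;
    WHILE Less (V ''p'') (V ''e'') DO (
      IF Elem_Less (V ''p'') (V ''f'')
      THEN (Move (V ''f'' \<oplus> N 1 \<oplus> V ''c1'') (V ''p'');; ''c1'' ::= V ''c1'' \<oplus> N 1)
      ELSE (IF Elem_Less (V ''f'') (V ''p'')
            THEN (Move (V ''f'' \<oplus> N 1 \<oplus> V ''n'' \<oplus> V ''c2'') (V ''p'');; ''c2'' ::= V ''c2'' \<oplus> N 1)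
            ELSE SKIP);;
      ''p'' ::= V ''p'' \<oplus> N 1)"

text \<open>
  The current sequence consists of the \<open>n\<close> cells from address \<open>b\<close> on, and the cells from
  address \<open>f\<close> on are free. The parameters are the group size \<open>g\<close>, the size \<open>n0\<close> up to which
  the sequence is sorted directly, the kind of median \<open>d\<close> taken in the first grouping step and
  those taken in the repeated grouping steps (one for each element of \<open>ds\<close>).
\<close>

definition grouping_select :: "nat \<Rightarrow> nat \<Rightarrow> median \<Rightarrow> median list \<Rightarrow> com" where
  "grouping_select g n0 d ds =
    ''done'' ::= N 0;;
    WHILE Equal (V ''done'') (N 0) DO (
      IF Less (V ''n'') (N (n0 + 1))
      THEN (
        insertion_sort (V ''b'') (V ''b'' \<oplus> V ''n'');;
        ''r'' ::= V ''b'' \<oplus> V ''i'' \<ominus> N 1;;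
        ''done'' ::= N 1)
      ELSE (
        group_medians g d (V ''b'') (V ''n'');;
        repeat_grouping g ds;;
        Call ''m'' [(''b'', V ''f''), (''n'', V ''k''), (''i'', Half (V ''k'' \<oplus> N 1)),
                    (''f'', V ''f'' \<oplus> V ''k'')];;
        Move (V ''f'') (V ''m'');;
        partition_sequence;;
        IF Equal (V ''c1'') (V ''i'' \<ominus> N 1)
        THEN (
          ''r'' ::= V ''f'';;
          ''done'' ::= N 1)
        ELSE (
          ''e'' ::= V ''f'' \<oplus> N 1 \<oplus> V ''n'' \<oplus> V ''n'';;
          IF Less (V ''i'' \<ominus> N 1) (V ''c1'')
          THEN (
            ''b'' ::= V ''f'' \<oplus> N 1;;
            ''n'' ::= V ''c1'')
          ELSE (
            ''b'' ::= V ''f'' \<oplus> N 1 \<oplus> V ''n'';;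
            ''n'' ::= V ''c2'';;
            ''i'' ::= V ''i'' \<ominus> V ''c1'' \<ominus> N 1);;
          ''f'' ::= V ''e'')))"

definition grouping_and_partition_algorithm :: "nat \<Rightarrow> com \<Rightarrow> bool" where
  "grouping_and_partition_algorithm g P \<longleftrightarrow> (\<exists>n0 d ds. P = grouping_select g n0 d ds)"

end

theory Submission
  imports Defs "HOL-Library.Disjoint_Sets"
begin

text \<open>
  If every element of a sequence stands for a block of the input with at least \<open>lo\<close> elements not
  above it and at least \<open>hi\<close> elements not below it, then the \<open>r\<close>th smallest element of a group of
  \<open>g\<close> such elements stands for the union of their blocks with \<open>r \<cdot> lo\<close> and \<open>(g + 1 - r) \<cdot> hi\<close>
  instead. Two grouping steps yield \<open>lo = hi = 4\<close> for \<open>g = 3\<close>, and \<open>lo = hi = 6\<close> for \<open>g = 4\<close> when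
  lower medians are followed by upper ones. As soon as \<open>lo, hi \<ge> 3\<close>, the median of the remaining \<open>k\<close>
  elements leaves at most \<open>n' \<le> n - 3 k / 2\<close> elements on either side, so that
  \<open>k + n' \<le> n - k / 2\<close>; since \<open>k\<close> is a constant fraction of \<open>n\<close>, the total time is linear.
\<close>

section \<open>A total-correctness calculus in which the running time is a budget\<close>

section \<open>Execution within a time budget\<close>

text \<open>The threshold 3 comes from the recursion: bounds \<open>lo\<close> and \<open>hi\<close>
  leave at most n - k * min(lo, hi) / 2 elements on a side, and adding the k medians stays strictly
  below n only if the minimum exceeds 2. One step gives 2 and 2 for groups of three, and 2 and 3 for
  groups of four; the two subproblems may then have total size n, and the estimate yields only O(n
  log n). A second step multiplies the bounds, while k remains a constant fraction of n. Alternating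
  the kind of median for g = 4 makes the two bounds equal.

  The other difficulty is that the algorithm is a concrete program whose recursive calls share one
  memory. Specifications therefore carry frame conditions, which is why the current sequence
  survives a call. Contents of an address range are tracked only as a set of values: the elements
  are distinct, so this set determines all ranks however the range is rearranged. Recursive call and
  main loop fall under one induction on the length of the sequence, since continuing the loop
  amounts to restarting the program.\<close>

definition runs :: "com \<Rightarrow> com \<Rightarrow> 'a::linorder state \<Rightarrow> nat \<Rightarrow> ('a state \<Rightarrow> bool) \<Rightarrow> bool" where
  "runs P c \<sigma> T Q \<longleftrightarrow> (\<exists>t \<sigma>'. P \<turnstile> (c, \<sigma>) \<Rightarrow>[t] \<sigma>' \<and> t \<le> T \<and> Q \<sigma>')"

lemma runs_mono:
  assumes "runs P c \<sigma> T Q" "T \<le> T'" "\<And>\<sigma>'. Q \<sigma>' \<Longrightarrow> Q' \<sigma>'"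
  shows "runs P c \<sigma> T' Q'"
  using assms unfolding runs_def by (meson le_trans)

lemma exec_SKIP_iff: "P \<turnstile> (SKIP, \<sigma>) \<Rightarrow>[t] \<sigma>' \<longleftrightarrow> t = 1 \<and> \<sigma>' = \<sigma>"
  by (auto elim: exec_SkipE intro: exec.Skip[simplified])

lemma exec_Assign_iff:
  "P \<turnstile> (x ::= a, (s, M)) \<Rightarrow>[t] \<sigma>' \<longleftrightarrow> t = acost a + 1 \<and> \<sigma>' = (s(x := aval a s), M)"
  by (auto elim!: exec_AssignE intro: exec.Assign[simplified])

lemma exec_Move_iff:
  "P \<turnstile> (Move a b, (s, M)) \<Rightarrow>[t] \<sigma>' \<longleftrightarrow>
    t = acost a + acost b + 1 \<and> \<sigma>' = (s, M(aval a s := M (aval b s)))"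
  by (auto elim!: exec_MoveE intro: exec.Move[simplified])

lemma exec_Seq_iff:
  "P \<turnstile> (c1 ;; c2, \<sigma>) \<Rightarrow>[t] \<sigma>' \<longleftrightarrow>
    (\<exists>t1 t2 \<tau>. t = t1 + t2 \<and> P \<turnstile> (c1, \<sigma>) \<Rightarrow>[t1] \<tau> \<and> P \<turnstile> (c2, \<tau>) \<Rightarrow>[t2] \<sigma>')"
  by (blast elim!: exec_SeqE intro: exec.Seq)

lemma exec_If_iff:
  "P \<turnstile> (IF p THEN c1 ELSE c2, \<sigma>) \<Rightarrow>[t] \<sigma>' \<longleftrightarrow>
    (\<exists>u. t = bcost p + 1 + u \<and> P \<turnstile> (if bval p \<sigma> then c1 else c2, \<sigma>) \<Rightarrow>[u] \<sigma>')"
  by (auto elim!: exec_IfE intro: exec.IfTrue[simplified] exec.IfFalse[simplified])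

lemma exec_While_True_iff:
  assumes "bval p \<sigma>"
  shows "P \<turnstile> (WHILE p DO c, \<sigma>) \<Rightarrow>[t] \<sigma>' \<longleftrightarrow>
    (\<exists>u. t = bcost p + 1 + u \<and> P \<turnstile> (c ;; WHILE p DO c, \<sigma>) \<Rightarrow>[u] \<sigma>')"
    (is "?L \<longleftrightarrow> ?R")
proof
  assume ?L
  then show ?R
  proof (rule exec_WhileE)
    fix t1 \<tau> t2
    assume "t = Suc (bcost p + t1 + t2)" "P \<turnstile> (c, \<sigma>) \<Rightarrow>[t1] \<tau>" "P \<turnstile> (WHILE p DO c, \<tau>) \<Rightarrow>[t2] \<sigma>'"
    then have "t = bcost p + 1 + (t1 + t2) \<and> P \<turnstile> (c ;; WHILE p DO c, \<sigma>) \<Rightarrow>[t1 + t2] \<sigma>'"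
      by (auto intro: exec.Seq)
    then show ?R by blast
  qed (use assms in simp)
next
  assume ?R
  then obtain t1 t2 \<tau> where "t = bcost p + t1 + t2 + 1"
      "P \<turnstile> (c, \<sigma>) \<Rightarrow>[t1] \<tau>" "P \<turnstile> (WHILE p DO c, \<tau>) \<Rightarrow>[t2] \<sigma>'"
    by (auto simp: exec_Seq_iff)
  then show ?L using exec.WhileTrue assms by blast
qed

lemma exec_While_False_iff:
  assumes "\<not> bval p \<sigma>"
  shows "P \<turnstile> (WHILE p DO c, \<sigma>) \<Rightarrow>[t] \<sigma>' \<longleftrightarrow> t = bcost p + 1 \<and> \<sigma>' = \<sigma>"
  using assms exec.WhileFalse[OF assms] by (auto elim: exec_WhileE)

text \<open>Common source of most rewrite rules for sequences: a first step of fixed cost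
  \<open>k\<close> into a known configuration is executed symbolically and paid from the budget. The
  conjunct \<open>k \<le> T\<close> guards the truncated subtraction \<open>T - k\<close>; as the
  rule is an equivalence, \<open>simp\<close> can run straight-line code.\<close>

lemma runs_prefix:
  assumes "\<And>t \<sigma>'. P \<turnstile> (c, \<sigma>) \<Rightarrow>[t] \<sigma>' \<longleftrightarrow> (\<exists>u. t = k + u \<and> P \<turnstile> (c', \<tau>) \<Rightarrow>[u] \<sigma>')"
  shows "runs P c \<sigma> T Q \<longleftrightarrow> k \<le> T \<and> runs P c' \<tau> (T - k) Q"
proof -
  have "k + u \<le> T \<longleftrightarrow> k \<le> T \<and> u \<le> T - k" for u by linarith
  then show ?thesis unfolding runs_def assms by blast
qed

lemma runs_SKIP [simp]: "runs P SKIP \<sigma> T Q \<longleftrightarrow> 1 \<le> T \<and> Q \<sigma>"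
  unfolding runs_def exec_SKIP_iff by blast

lemma runs_Assign [simp]:
  "runs P (x ::= a) (s, M) T Q \<longleftrightarrow> acost a + 1 \<le> T \<and> Q (s(x := aval a s), M)"
  unfolding runs_def exec_Assign_iff by blast

lemma runs_Seq:
  assumes "runs P c1 \<sigma> T1 R" "T1 \<le> T" "\<And>\<sigma>'. R \<sigma>' \<Longrightarrow> runs P c2 \<sigma>' (T - T1) Q"
  shows "runs P (c1 ;; c2) \<sigma> T Q"
proof -
  obtain t1 \<tau> where 1: "P \<turnstile> (c1, \<sigma>) \<Rightarrow>[t1] \<tau>" "t1 \<le> T1" "R \<tau>"
    using assms(1) unfolding runs_def by blast
  obtain t2 \<sigma>' where 2: "P \<turnstile> (c2, \<tau>) \<Rightarrow>[t2] \<sigma>'" "t2 \<le> T - T1" "Q \<sigma>'"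
    using assms(3)[OF 1(3)] unfolding runs_def by blast
  have "t1 + t2 \<le> T" using 1 2 assms(2) by linarith
  then show ?thesis unfolding runs_def using exec.Seq[OF 1(1) 2(1)] 2(3) by blast
qed

text \<open>A branch of a conditional becomes the left part of a sequence once its continuation
  follows. Nesting to the right exposes the next atomic command to the rewrite rules.\<close>

lemma runs_Seq_assoc [simp]: "runs P ((c1 ;; c2) ;; c3) \<sigma> T Q \<longleftrightarrow> runs P (c1 ;; c2 ;; c3) \<sigma> T Q"
proof -
  have "P \<turnstile> ((c1 ;; c2) ;; c3, \<sigma>) \<Rightarrow>[t] \<sigma>' \<longleftrightarrow> P \<turnstile> (c1 ;; c2 ;; c3, \<sigma>) \<Rightarrow>[t] \<sigma>'" for t \<sigma>'
  proof
    assume "P \<turnstile> ((c1 ;; c2) ;; c3, \<sigma>) \<Rightarrow>[t] \<sigma>'"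
    then obtain t1 t2 t3 \<tau>1 \<tau>2 where "t = t1 + (t2 + t3)" "P \<turnstile> (c1, \<sigma>) \<Rightarrow>[t1] \<tau>1"
        "P \<turnstile> (c2, \<tau>1) \<Rightarrow>[t2] \<tau>2" "P \<turnstile> (c3, \<tau>2) \<Rightarrow>[t3] \<sigma>'"
      unfolding exec_Seq_iff add.assoc[symmetric] by blast
    then show "P \<turnstile> (c1 ;; c2 ;; c3, \<sigma>) \<Rightarrow>[t] \<sigma>'"
      unfolding exec_Seq_iff by blast
  next
    assume "P \<turnstile> (c1 ;; c2 ;; c3, \<sigma>) \<Rightarrow>[t] \<sigma>'"
    then obtain t1 t2 t3 \<tau>1 \<tau>2 where "t = (t1 + t2) + t3" "P \<turnstile> (c1, \<sigma>) \<Rightarrow>[t1] \<tau>1"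
        "P \<turnstile> (c2, \<tau>1) \<Rightarrow>[t2] \<tau>2" "P \<turnstile> (c3, \<tau>2) \<Rightarrow>[t3] \<sigma>'"
      unfolding exec_Seq_iff add.assoc by blast
    then show "P \<turnstile> ((c1 ;; c2) ;; c3, \<sigma>) \<Rightarrow>[t] \<sigma>'"
      unfolding exec_Seq_iff by blast
  qed
  then show ?thesis unfolding runs_def by simp
qed

lemma runs_SKIP_Seq [simp]:
  "runs P (SKIP ;; c) \<sigma> T Q \<longleftrightarrow> 1 \<le> T \<and> runs P c \<sigma> (T - 1) Q"
  by (rule runs_prefix) (unfold exec_Seq_iff exec_SKIP_iff, blast)

lemma runs_Assign_Seq [simp]:
  "runs P (x ::= a ;; c) (s, M) T Q \<longleftrightarrow>
    acost a + 1 \<le> T \<and> runs P c (s(x := aval a s), M) (T - (acost a + 1)) Q"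
  by (rule runs_prefix) (unfold exec_Seq_iff exec_Assign_iff, blast)

lemma runs_Move_Seq [simp]:
  "runs P (Move a b ;; c) (s, M) T Q \<longleftrightarrow>
    acost a + acost b + 1 \<le> T \<and>
    runs P c (s, M(aval a s := M (aval b s))) (T - (acost a + acost b + 1)) Q"
  by (rule runs_prefix) (unfold exec_Seq_iff exec_Move_iff, blast)

lemma runs_If_Seq [simp]:
  "runs P ((IF p THEN c1 ELSE c2) ;; c3) \<sigma> T Q \<longleftrightarrow>
    bcost p + 1 \<le> T \<and> runs P ((if bval p \<sigma> then c1 else c2) ;; c3) \<sigma> (T - (bcost p + 1)) Q"
proof (rule runs_prefix)
  let ?c = "if bval p \<sigma> then c1 else c2"
  fix t \<sigma>'
  show "P \<turnstile> ((IF p THEN c1 ELSE c2) ;; c3, \<sigma>) \<Rightarrow>[t] \<sigma>' \<longleftrightarrow>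
    (\<exists>u. t = bcost p + 1 + u \<and> P \<turnstile> (?c ;; c3, \<sigma>) \<Rightarrow>[u] \<sigma>')" (is "?L \<longleftrightarrow> ?R")
  proof
    assume ?L
    then obtain u v \<tau> where t: "t = (bcost p + 1 + u) + v"
        and "P \<turnstile> (?c, \<sigma>) \<Rightarrow>[u] \<tau>" "P \<turnstile> (c3, \<tau>) \<Rightarrow>[v] \<sigma>'"
      unfolding exec_Seq_iff exec_If_iff by blast
    then have "P \<turnstile> (?c ;; c3, \<sigma>) \<Rightarrow>[u + v] \<sigma>'" by (blast intro: exec.Seq)
    then show ?R using t add.assoc by blast
  next
    assume ?R
    then obtain u v \<tau> where "t = bcost p + 1 + (u + v)"
        "P \<turnstile> (?c, \<sigma>) \<Rightarrow>[u] \<tau>" "P \<turnstile> (c3, \<tau>) \<Rightarrow>[v] \<sigma>'"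
      unfolding exec_Seq_iff by blast
    then show ?L unfolding exec_Seq_iff exec_If_iff add.assoc[symmetric] by blast
  qed
qed

lemma runs_While_unfold:
  "runs P (WHILE p DO c) \<sigma> T Q \<longleftrightarrow>
    bcost p + 1 \<le> T \<and>
    (if bval p \<sigma> then runs P (c ;; WHILE p DO c) \<sigma> (T - (bcost p + 1)) Q else Q \<sigma>)"
proof (cases "bval p \<sigma>")
  case True
  then show ?thesis using runs_prefix[OF exec_While_True_iff] by simp
next
  case False
  then show ?thesis by (simp add: runs_def exec_While_False_iff del: split_paired_Ex)
qed

text \<open>The variant \<open>v\<close> bounds the number of iterations even if it drops by more
  than one at a time. Each iteration pays \<open>C\<close> for the body and
  \<open>bcost p + 1\<close> for its test; the final \<open>bcost p + 1\<close> is the failing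
  test.\<close>

lemma runs_While:
  fixes v :: "'a::linorder state \<Rightarrow> nat"
  assumes "I \<sigma>"
    and "\<And>\<sigma>. I \<sigma> \<Longrightarrow> bval p \<sigma> \<Longrightarrow> runs P c \<sigma> C (\<lambda>\<sigma>'. I \<sigma>' \<and> v \<sigma>' < v \<sigma>)"
    and "v \<sigma> * (C + bcost p + 1) + bcost p + 1 \<le> T"
    and "\<And>\<sigma>. I \<sigma> \<Longrightarrow> \<not> bval p \<sigma> \<Longrightarrow> Q \<sigma>"
  shows "runs P (WHILE p DO c) \<sigma> T Q"
  using assms(1,3)
proof (induction "v \<sigma>" arbitrary: \<sigma> T rule: less_induct)
  case less
  show ?case
  proof (cases "bval p \<sigma>")
    case True
    let ?D = "C + bcost p + 1"
    have step: "runs P c \<sigma> C (\<lambda>\<sigma>'. I \<sigma>' \<and> v \<sigma>' < v \<sigma>)"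
      using assms(2) less.prems(1) True by blast
    then have "v \<sigma> \<ge> 1" unfolding runs_def by auto
    then have ge: "?D \<le> v \<sigma> * ?D" using mult_right_mono[of 1 "v \<sigma>" ?D] by simp
    have "runs P (c ;; WHILE p DO c) \<sigma> (T - (bcost p + 1)) Q"
    proof (rule runs_Seq[OF step])
      show "C \<le> T - (bcost p + 1)" using ge less.prems(2) by linarith
    next
      fix \<sigma>' assume s': "I \<sigma>' \<and> v \<sigma>' < v \<sigma>"
      then have "(v \<sigma>' + 1) * ?D \<le> v \<sigma> * ?D" by (intro mult_right_mono) auto
      then have "v \<sigma>' * ?D + ?D \<le> v \<sigma> * ?D" by (simp add: algebra_simps)
      then have "v \<sigma>' * ?D + bcost p + 1 \<le> T - (bcost p + 1) - C"
        using less.prems(2) by linarith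
      then show "runs P (WHILE p DO c) \<sigma>' (T - (bcost p + 1) - C) Q"
        using less.hyps s' by blast
    qed
    then show ?thesis using True less.prems(2) by (subst runs_While_unfold) auto
  next
    case False
    then show ?thesis using less.prems assms(4) by (subst runs_While_unfold) auto
  qed
qed

lemma runs_Call:
  assumes "runs P P (frame (map (\<lambda>(y, a). (y, aval a s)) args), M) T1
      (\<lambda>(s', M'). Q (s(x := s' ''r''), M'))"
    and "(\<Sum>(y, a)\<leftarrow>args. acost a + 1) + T1 + 1 \<le> T"
  shows "runs P (Call x args) (s, M) T Q"
proof -
  obtain t s' M' where
    *: "P \<turnstile> (P, (frame (map (\<lambda>(y, a). (y, aval a s)) args), M)) \<Rightarrow>[t] (s', M')" "t \<le> T1"
      "Q (s(x := s' ''r''), M')"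
    using assms(1) unfolding runs_def by auto
  have "(\<Sum>(y, a)\<leftarrow>args. acost a + 1) + t + 1 \<le> T" using *(2) assms(2) by linarith
  then show ?thesis unfolding runs_def using exec.Call[OF *(1)] *(3) by blast
qed


section \<open>Sorting in place with one scratch cell\<close>

section \<open>Insertion sort\<close>

text \<open>Worst case for bounds of cost at most 3. An inner iteration costs 21 for its body and 12
  for its test, hence \<open>33 * w\<close>; the 24 consists of the failing inner test (12), two
  assignments (6) and the outer test (6). The final 10 is the initial assignment and the failing
  outer test.\<close>

definition sort_time :: "nat \<Rightarrow> nat" where
  "sort_time w = w * (33 * w + 24) + 10"

lemma sort_time_mono: "v \<le> w \<Longrightarrow> sort_time v \<le> sort_time w"
  unfolding sort_time_def by (intro add_mono mult_mono) auto

lemma image_swap: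
  assumes "a \<in> I" "b \<in> I"
  shows "(M(a := M b, b := M a)) ` I = M ` I"
  using assms by (auto simp: fun_upd_def image_iff split: if_splits)

text \<open>The assumptions on \<open>lo\<close> and \<open>hi\<close> express semantically that
  these bounds do not depend on the registers \<open>j\<close> and \<open>l\<close>. Swaps pass
  through the scratch cell \<open>f + n\<close>; \<open>tmp\<close> puts it beyond the sorted range,
  and the frame condition exempts it. That the result is a rearrangement is recorded only as
  equality of images.\<close>

lemma runs_insertion_sort:
  fixes M :: "nat \<Rightarrow> 'a::linorder"
  assumes lo: "\<And>s'. (\<forall>x. x \<notin> {''j'', ''l''} \<longrightarrow> s' x = s x) \<Longrightarrow> aval lo s' = a"
    and hi: "\<And>s'. (\<forall>x. x \<notin> {''j'', ''l''} \<longrightarrow> s' x = s x) \<Longrightarrow> aval hi s' = a + w"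
    and cost: "acost lo \<le> 3" "acost hi \<le> 3"
    and tmp: "a + w \<le> s ''f'' + s ''n''"
    and T: "sort_time w \<le> T"
    and Q: "\<And>s' M'. \<lbrakk>\<forall>x. x \<notin> {''j'', ''l''} \<longrightarrow> s' x = s x;
        \<forall>c. c \<notin> {a..<a + w} \<and> c \<noteq> s ''f'' + s ''n'' \<longrightarrow> M' c = M c;
        M' ` {a..<a + w} = M ` {a..<a + w};
        \<forall>c d. a \<le> c \<and> c \<le> d \<and> d < a + w \<longrightarrow> M' c \<le> M' d\<rbrakk> \<Longrightarrow> Q (s', M')"
  shows "runs P (insertion_sort lo hi) (s, M) T Q"
proof -
  define t where "t = s ''f'' + s ''n''"
  define same where "same = (\<lambda>s' M'. (\<forall>x. x \<notin> {''j'', ''l''} \<longrightarrow> s' x = s x) \<and>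
      (\<forall>c. c \<notin> {a..<a + w} \<and> c \<noteq> t \<longrightarrow> M' c = M c) \<and> M' ` {a..<a + w} = M ` {a..<a + w})"
  define I where "I = (\<lambda>(s', M'). same s' M' \<and> a \<le> s' ''j'' \<and> s' ''j'' \<le> a + w \<and>
      (\<forall>c d. a \<le> c \<and> c \<le> d \<and> d < s' ''j'' \<longrightarrow> M' c \<le> M' d))"
  \<comment> \<open>Cells up to \<open>j\<close> are in order except that \<open>l\<close> is exempt
    as the upper index: the element being inserted may be smaller than its predecessors, but not
    larger than its successors.\<close>
  define J where "J = (\<lambda>j (s', M'). same s' M' \<and> s' ''j'' = j \<and> a \<le> s' ''l'' \<and> s' ''l'' \<le> j \<and>
      (\<forall>c d. a \<le> c \<and> c \<le> d \<and> d \<le> j \<and> d \<noteq> s' ''l'' \<longrightarrow> M' c \<le> M' d))"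
  have lo': "aval lo s' = a" and hi': "aval hi s' = a + w" and t': "s' ''f'' + s' ''n'' = t"
    if "same s' M'" for s' M'
    using that lo[of s'] hi[of s'] unfolding same_def t_def by auto
  have inner: "runs P (WHILE Conj (Less lo (V ''l'')) (Elem_Less (V ''l'') (V ''l'' \<ominus> N 1)) DO (
        Move (V ''f'' \<oplus> V ''n'') (V ''l'');;
        Move (V ''l'') (V ''l'' \<ominus> N 1);;
        Move (V ''l'' \<ominus> N 1) (V ''f'' \<oplus> V ''n'');;
        ''l'' ::= V ''l'' \<ominus> N 1)) (s1, M1) (33 * w + 12)
        (\<lambda>(s', M'). same s' M' \<and> s' ''j'' = j \<and> (\<forall>c d. a \<le> c \<and> c \<le> d \<and> d \<le> j \<longrightarrow> M' c \<le> M' d))"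
    if J1: "J j (s1, M1)" and j: "j < a + w" for s1 j and M1 :: "nat \<Rightarrow> 'a"
  proof (rule runs_While[where I = "J j" and C = 21 and v = "\<lambda>(s', M'). s' ''l'' - a"])
    show "J j (s1, M1)" by fact
  next
    fix \<sigma> :: "'a state"
    assume J: "J j \<sigma>" and b: "bval (Conj (Less lo (V ''l'')) (Elem_Less (V ''l'') (V ''l'' \<ominus> N 1))) \<sigma>"
    obtain s2 M2 where \<sigma>: "\<sigma> = (s2, M2)" by fastforce
    define l where "l = s2 ''l''"
    from J have sm: "same s2 M2" and jj: "s2 ''j'' = j" and l: "a \<le> l" "l \<le> j"
      and srt: "\<And>c d. a \<le> c \<Longrightarrow> c \<le> d \<Longrightarrow> d \<le> j \<Longrightarrow> d \<noteq> l \<Longrightarrow> M2 c \<le> M2 d"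
      unfolding \<sigma> J_def l_def by auto
    from b lo'[OF sm] have al: "a < l" and lt: "M2 l < M2 (l - 1)"
      unfolding \<sigma> l_def by auto
    have tl: "t \<noteq> l" "t \<noteq> l - 1" "t \<notin> {a..<a + w}" using tmp j l unfolding t_def by auto
    define M3 where "M3 = M2(t := M2 l, l := M2 (l - 1), l - 1 := M2 l)"
    have eq: "M3 c = (if c = l then M2 (l - 1) else if c = l - 1 then M2 l
        else if c = t then M2 l else M2 c)" for c
      using al tl unfolding M3_def by auto
    have "M3 ` {a..<a + w} = (M2(l := M2 (l - 1), l - 1 := M2 l)) ` {a..<a + w}"
      using tl unfolding M3_def by (intro image_cong) auto
    moreover have "(M2(l := M2 (l - 1), l - 1 := M2 l)) ` {a..<a + w} = M2 ` {a..<a + w}"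
      by (rule image_swap[of l _ "l - 1" M2]) (use al l j in auto)
    ultimately have img: "M3 ` {a..<a + w} = M2 ` {a..<a + w}" by (rule trans)
    have sm3: "same (s2(''l'' := l - 1)) M3"
    proof -
      have "M3 c = M2 c" if "c \<notin> {a..<a + w}" "c \<noteq> t" for c
        using that al l j unfolding eq by auto
      then show ?thesis using sm img unfolding same_def by simp
    qed
    have srt3: "M3 c \<le> M3 d" if "a \<le> c" "c \<le> d" "d \<le> j" "d \<noteq> l - 1" for c d
    proof -
      note cd = that
      have "c \<in> {a..<a + w}" "d \<in> {a..<a + w}" using that j by simp_all
      then have "c \<noteq> t" "d \<noteq> t" using tl(3) by blast+
      \<comment> \<open>Positions of the pair relative to the two swapped cells. Only the pair
        \<open>l - 1\<close>, \<open>l\<close> uses the comparison \<open>lt\<close>; the other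
        nontrivial cases are instances of the old invariant with swapped indices.\<close>
      consider "c = d" | "c = l - 1" "d = l" | "c < l - 1" "d = l" | "c = l - 1" "d > l"
        | "c = l" "d > l" | "c < d" "c \<noteq> l" "c \<noteq> l - 1" "d \<noteq> l"
        using cd al by linarith
      then show ?thesis
      proof cases
        case 2 then show ?thesis using lt al by (simp add: eq less_imp_le)
      next
        case 3 then show ?thesis using srt[of c "l - 1"] that l al \<open>c \<noteq> t\<close> by (simp add: eq)
      next
        case 4 then show ?thesis using srt[of l d] that l al \<open>d \<noteq> t\<close> by (simp add: eq)
      next
        case 5 then show ?thesis using srt[of "l - 1" d] that l al \<open>d \<noteq> t\<close> by (simp add: eq)
      next
        case 6 then show ?thesis using srt[of c d] that \<open>c \<noteq> t\<close> \<open>d \<noteq> t\<close> by (simp add: eq)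
      qed simp
    qed
    have J3: "J j (s2(''l'' := l - 1), M3)"
      using sm3 jj al l srt3 unfolding J_def by auto
    have M3': "M2(t := M2 l, l := M2 (l - Suc 0), l - Suc 0 := M2 l) = M3"
      using M3_def by simp
    show "runs P (Move (V ''f'' \<oplus> V ''n'') (V ''l'');;
        Move (V ''l'') (V ''l'' \<ominus> N 1);;
        Move (V ''l'' \<ominus> N 1) (V ''f'' \<oplus> V ''n'');;
        ''l'' ::= V ''l'' \<ominus> N 1) \<sigma> 21
        (\<lambda>\<sigma>'. J j \<sigma>' \<and> (case \<sigma>' of (s', M') \<Rightarrow> s' ''l'' - a) < (case \<sigma> of (s', M') \<Rightarrow> s' ''l'' - a))"
      using J3 tl al t'[OF sm] by (simp add: \<sigma> l_def[symmetric] M3' diff_less_mono)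
  next
    have "(s1 ''l'' - a) * (21 + (acost lo + 8) + 1) \<le> w * 33"
      using J1 j cost unfolding J_def by (intro mult_mono) auto
    then show "(case (s1, M1) of (s', M') \<Rightarrow> s' ''l'' - a) *
        (21 + bcost (Conj (Less lo (V ''l'')) (Elem_Less (V ''l'') (V ''l'' \<ominus> N 1))) + 1) +
        bcost (Conj (Less lo (V ''l'')) (Elem_Less (V ''l'') (V ''l'' \<ominus> N 1))) + 1 \<le> 33 * w + 12"
      using cost by simp
  next
    fix \<sigma> :: "'a state"
    assume J: "J j \<sigma>" and b: "\<not> bval (Conj (Less lo (V ''l'')) (Elem_Less (V ''l'') (V ''l'' \<ominus> N 1))) \<sigma>"
    obtain s2 M2 where \<sigma>: "\<sigma> = (s2, M2)" by fastforce
    define l where "l = s2 ''l''"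
    from J have sm: "same s2 M2" and jj: "s2 ''j'' = j" and l: "a \<le> l" "l \<le> j"
      and srt: "\<And>c d. a \<le> c \<Longrightarrow> c \<le> d \<Longrightarrow> d \<le> j \<Longrightarrow> d \<noteq> l \<Longrightarrow> M2 c \<le> M2 d"
      unfolding \<sigma> J_def l_def by auto
    from b lo'[OF sm] have ge: "l = a \<or> M2 (l - 1) \<le> M2 l"
      using l unfolding \<sigma> l_def by auto
    have "M2 c \<le> M2 d" if "a \<le> c" "c \<le> d" "d \<le> j" for c d
    proof (cases "d = l \<and> c < l")
      case True
      then show ?thesis using ge srt[of c "l - 1"] that l by force
    next
      case False
      then show ?thesis using srt[of c d] that by (cases "c = d") auto
    qed
    then show "case \<sigma> of (s', M') \<Rightarrow> same s' M' \<and> s' ''j'' = j \<and>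
        (\<forall>c d. a \<le> c \<and> c \<le> d \<and> d \<le> j \<longrightarrow> M' c \<le> M' d)"
      using sm jj by (auto simp: \<sigma>)
  qed
  have "runs P (WHILE Less (V ''j'') hi DO (
      ''l'' ::= V ''j'';;
      WHILE Conj (Less lo (V ''l'')) (Elem_Less (V ''l'') (V ''l'' \<ominus> N 1)) DO (
        Move (V ''f'' \<oplus> V ''n'') (V ''l'');;
        Move (V ''l'') (V ''l'' \<ominus> N 1);;
        Move (V ''l'' \<ominus> N 1) (V ''f'' \<oplus> V ''n'');;
        ''l'' ::= V ''l'' \<ominus> N 1);;
      ''j'' ::= V ''j'' \<oplus> N 1)) (s(''j'' := a), M) (T - (acost lo + 1)) Q"
  proof (rule runs_While[where I = I and C = "33 * w + 18" and v = "\<lambda>(s', M'). a + w - s' ''j''"])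
    show "I (s(''j'' := a), M)" unfolding I_def same_def by auto
  next
    fix \<sigma> :: "'a state"
    assume I: "I \<sigma>" and b: "bval (Less (V ''j'') hi) \<sigma>"
    obtain s1 M1 where \<sigma>: "\<sigma> = (s1, M1)" by fastforce
    define j where "j = s1 ''j''"
    from I have sm: "same s1 M1" unfolding \<sigma> I_def by auto
    have jw: "j < a + w" using b hi'[OF sm] by (simp add: \<sigma> j_def)
    have J1: "J j (s1(''l'' := j), M1)"
      using I unfolding \<sigma> I_def J_def j_def same_def by auto
    have "runs P (WHILE Conj (Less lo (V ''l'')) (Elem_Less (V ''l'') (V ''l'' \<ominus> N 1)) DO (
        Move (V ''f'' \<oplus> V ''n'') (V ''l'');;
        Move (V ''l'') (V ''l'' \<ominus> N 1);;
        Move (V ''l'' \<ominus> N 1) (V ''f'' \<oplus> V ''n'');;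
        ''l'' ::= V ''l'' \<ominus> N 1) ;;
      ''j'' ::= V ''j'' \<oplus> N 1) (s1(''l'' := j), M1) (33 * w + 18 - 2)
        (\<lambda>\<sigma>'. I \<sigma>' \<and> (case \<sigma>' of (s', M') \<Rightarrow> a + w - s' ''j'') < (case \<sigma> of (s', M') \<Rightarrow> a + w - s' ''j''))"
    proof (rule runs_Seq[OF inner[OF J1 jw]])
      fix \<sigma>' :: "'a state"
      assume *: "case \<sigma>' of (s', M') \<Rightarrow> same s' M' \<and> s' ''j'' = j \<and>
          (\<forall>c d. a \<le> c \<and> c \<le> d \<and> d \<le> j \<longrightarrow> M' c \<le> M' d)"
      obtain s' M' where \<sigma>': "\<sigma>' = (s', M')" by fastforce
      have "I (s'(''j'' := Suc j), M')"
        using * I jw unfolding I_def same_def \<sigma>' \<sigma> j_def by auto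
      then show "runs P (''j'' ::= V ''j'' \<oplus> N 1) \<sigma>' (33 * w + 18 - 2 - (33 * w + 12))
        (\<lambda>\<sigma>'. I \<sigma>' \<and> (case \<sigma>' of (s', M') \<Rightarrow> a + w - s' ''j'') < (case \<sigma> of (s', M') \<Rightarrow> a + w - s' ''j''))"
        using * jw by (auto simp: \<sigma>' \<sigma> j_def)
    qed simp
    then show "runs P (''l'' ::= V ''j'';;
      WHILE Conj (Less lo (V ''l'')) (Elem_Less (V ''l'') (V ''l'' \<ominus> N 1)) DO (
        Move (V ''f'' \<oplus> V ''n'') (V ''l'');;
        Move (V ''l'') (V ''l'' \<ominus> N 1);;
        Move (V ''l'' \<ominus> N 1) (V ''f'' \<oplus> V ''n'');;
        ''l'' ::= V ''l'' \<ominus> N 1);;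
      ''j'' ::= V ''j'' \<oplus> N 1) \<sigma> (33 * w + 18)
        (\<lambda>\<sigma>'. I \<sigma>' \<and> (case \<sigma>' of (s', M') \<Rightarrow> a + w - s' ''j'') < (case \<sigma> of (s', M') \<Rightarrow> a + w - s' ''j''))"
      by (simp add: \<sigma> j_def[symmetric])
  next
    have "w * (33 * w + 18 + (1 + acost hi + 1) + 1) \<le> w * (33 * w + 24)"
      using cost by (intro mult_left_mono) auto
    then have "w * (33 * w + 18 + (1 + acost hi + 1) + 1) + (1 + acost hi + 1) + 1 \<le> T - (acost lo + 1)"
      using cost T unfolding sort_time_def by linarith
    then show "(case (s(''j'' := a), M) of (s', M') \<Rightarrow> a + w - s' ''j'') *
        (33 * w + 18 + bcost (Less (V ''j'') hi) + 1) + bcost (Less (V ''j'') hi) + 1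
        \<le> T - (acost lo + 1)"
      by simp
  next
    fix \<sigma> :: "'a state"
    assume I: "I \<sigma>" and b: "\<not> bval (Less (V ''j'') hi) \<sigma>"
    obtain s1 M1 where \<sigma>: "\<sigma> = (s1, M1)" by fastforce
    from I have sm: "same s1 M1" unfolding \<sigma> I_def by auto
    have "s1 ''j'' = a + w" using I b hi'[OF sm] by (simp add: \<sigma> I_def)
    moreover have "\<forall>c d. a \<le> c \<and> c \<le> d \<and> d < s1 ''j'' \<longrightarrow> M1 c \<le> M1 d"
      using I by (simp add: \<sigma> I_def)
    ultimately have srt: "\<forall>c d. a \<le> c \<and> c \<le> d \<and> d < a + w \<longrightarrow> M1 c \<le> M1 d" by simp
    note sm' = sm[unfolded same_def t_def]
    show "Q \<sigma>" unfolding \<sigma>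
      by (rule Q[OF sm'[THEN conjunct1] sm'[THEN conjunct2, THEN conjunct1]
            sm'[THEN conjunct2, THEN conjunct2] srt])
  qed
  moreover have "aval lo s = a" by (rule lo) simp
  moreover have "acost lo + 1 \<le> T" using cost T unfolding sort_time_def by simp
  ultimately show ?thesis unfolding insertion_sort_def by simp
qed

section \<open>Disjoint blocks behind the medians, and counting with them\<close>

section \<open>Grouping\<close>

text \<open>Blocks are indexed by memory cells, so the predicate speaks of the current contents.
  They may leave part of \<open>S\<close> uncovered, which accommodates the elements that a grouping
  step leaves over. The representative belongs to its own block and is counted on both
  sides.\<close>

definition represents :: "(nat \<Rightarrow> 'a::linorder) \<Rightarrow> nat \<Rightarrow> nat \<Rightarrow> 'a set \<Rightarrow> nat \<Rightarrow> nat \<Rightarrow> bool" where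
  "represents M a k S lo hi \<longleftrightarrow> (\<exists>B. disjoint_family_on B {a..<a + k} \<and>
    (\<forall>c\<in>{a..<a + k}. finite (B c) \<and> B c \<subseteq> S \<and> M c \<in> B c \<and>
      lo \<le> card {y \<in> B c. y \<le> M c} \<and> hi \<le> card {y \<in> B c. M c \<le> y}))"

lemma represents_singletons:
  assumes "inj_on M {a..<a + k}"
  shows "represents M a k (M ` {a..<a + k}) 1 1"
proof -
  have "{y \<in> {M c}. y \<le> M c} = {M c}" "{y \<in> {M c}. M c \<le> y} = {M c}" for c by auto
  then show ?thesis unfolding represents_def
    using assms by (intro exI[of _ "\<lambda>c. {M c}"]) (auto simp: disjoint_family_on_def inj_on_def)
qed

lemma card_disjoint_family_ge:
  assumes "finite I" "disjoint_family_on D I" "finite E"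
    and "\<And>i. i \<in> I \<Longrightarrow> D i \<subseteq> E" "\<And>i. i \<in> I \<Longrightarrow> c \<le> card (D i)"
  shows "card I * c \<le> card E"
proof -
  have "card I * c \<le> (\<Sum>i\<in>I. card (D i))" using sum_bounded_below[of I c "\<lambda>i. card (D i)"] assms(5) by simp
  also have "\<dots> = card (\<Union>i\<in>I. D i)"
    using assms by (intro card_UN_disjoint'[symmetric]) (auto intro: finite_subset)
  also have "\<dots> \<le> card E" using assms by (intro card_mono) auto
  finally show ?thesis .
qed

text \<open>Equal representatives in different cells would be a common element of two disjoint
  blocks.\<close>

lemma represents_inj_on:
  assumes "represents M a k S lo hi"
  shows "inj_on M {a..<a + k}"
proof (rule inj_onI, rule ccontr)
  fix c d assume cd: "c \<in> {a..<a + k}" "d \<in> {a..<a + k}" "M c = M d" "c \<noteq> d"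
  obtain B where "disjoint_family_on B {a..<a + k}" "\<forall>c\<in>{a..<a + k}. M c \<in> B c"
    using assms unfolding represents_def by blast
  then show False using cd disjoint_family_onD by (metis IntI empty_iff)
qed

lemma represents_subset: "represents M a k S lo hi \<Longrightarrow> M ` {a..<a + k} \<subseteq> S"
  unfolding represents_def by blast

lemma card_filter_image:
  assumes "inj_on f I"
  shows "card {y \<in> f ` I. R y} = card {i \<in> I. R (f i)}"
proof -
  have "{y \<in> f ` I. R y} = f ` {i \<in> I. R (f i)}" by auto
  then show ?thesis using assms by (simp add: card_image inj_on_subset)
qed

text \<open>Every representative not above \<open>v\<close> contributes the lower part of its block,
  and these parts are disjoint. Counting over values instead of cells makes the bound indifferent to
  a later rearrangement. \<open>represents_ge\<close> is the mirror image.\<close>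

lemma represents_le:
  assumes "represents M a k S lo hi" "finite S"
  shows "card {y \<in> M ` {a..<a + k}. y \<le> v} * lo \<le> card {y \<in> S. y \<le> v}"
proof -
  obtain B where B: "disjoint_family_on B {a..<a + k}"
      "\<And>c. c \<in> {a..<a + k} \<Longrightarrow> B c \<subseteq> S \<and> lo \<le> card {y \<in> B c. y \<le> M c}"
    using assms(1) unfolding represents_def by blast
  let ?I = "{c \<in> {a..<a + k}. M c \<le> v}"
  have "disjoint_family_on (\<lambda>c. {y \<in> B c. y \<le> M c}) ?I"
    using B(1) unfolding disjoint_family_on_def by blast
  moreover have "{y \<in> B c. y \<le> M c} \<subseteq> {y \<in> S. y \<le> v}" if "c \<in> ?I" for c
    using B(2) that by force
  ultimately have "card ?I * lo \<le> card {y \<in> S. y \<le> v}"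
    using B(2) assms(2) by (intro card_disjoint_family_ge[where D = "\<lambda>c. {y \<in> B c. y \<le> M c}"]) auto
  then show ?thesis using card_filter_image[OF represents_inj_on[OF assms(1)]] by simp
qed

lemma represents_ge:
  assumes "represents M a k S lo hi" "finite S"
  shows "card {y \<in> M ` {a..<a + k}. v \<le> y} * hi \<le> card {y \<in> S. v \<le> y}"
proof -
  obtain B where B: "disjoint_family_on B {a..<a + k}"
      "\<And>c. c \<in> {a..<a + k} \<Longrightarrow> B c \<subseteq> S \<and> hi \<le> card {y \<in> B c. M c \<le> y}"
    using assms(1) unfolding represents_def by blast
  let ?I = "{c \<in> {a..<a + k}. v \<le> M c}"
  have "disjoint_family_on (\<lambda>c. {y \<in> B c. M c \<le> y}) ?I"
    using B(1) unfolding disjoint_family_on_def by blast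
  moreover have "{y \<in> B c. M c \<le> y} \<subseteq> {y \<in> S. v \<le> y}" if "c \<in> ?I" for c
    using B(2) that by force
  ultimately have "card ?I * hi \<le> card {y \<in> S. v \<le> y}"
    using B(2) assms(2) by (intro card_disjoint_family_ge[where D = "\<lambda>c. {y \<in> B c. M c \<le> y}"]) auto
  then show ?thesis using card_filter_image[OF represents_inj_on[OF assms(1)]] by simp
qed

text \<open>In sorted order, \<open>r\<close> representatives are at or below the \<open>r\<close>th
  one and \<open>g + 1 - r\<close> are at or above it, the representative itself being counted
  twice. The blocks belong to \<open>M\<close>, the order to \<open>M'\<close>; the common image
  connects them.\<close>

lemma represents_sorted:
  assumes rep: "represents M a g S lo hi" and fin: "finite S"
    and img: "M' ` {a..<a + g} = M ` {a..<a + g}"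
    and srt: "\<And>c d. a \<le> c \<Longrightarrow> c \<le> d \<Longrightarrow> d < a + g \<Longrightarrow> M' c \<le> M' d"
    and r: "1 \<le> r" "r \<le> g"
  defines "v \<equiv> M' (a + (r - 1))"
  shows "v \<in> S" "r * lo \<le> card {y \<in> S. y \<le> v}" "(g + 1 - r) * hi \<le> card {y \<in> S. v \<le> y}"
proof -
  \<comment> \<open>Sorting is known only to preserve the set of values. As that set has
    \<open>g\<close> elements, no value can occur twice after sorting.\<close>
  have inj: "inj_on M' {a..<a + g}"
    using img card_image[OF represents_inj_on[OF rep]] by (intro eq_card_imp_inj_on) auto
  have "v \<in> M' ` {a..<a + g}" using r unfolding v_def by (intro imageI) auto
  then show "v \<in> S" using img represents_subset[OF rep] by blast
  have "r = card (M' ` {a..<a + r})"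
    using r by (subst card_image[OF inj_on_subset[OF inj]]) auto
  also have "\<dots> \<le> card {y \<in> M' ` {a..<a + g}. y \<le> v}"
    using r srt unfolding v_def by (intro card_mono) auto
  finally show "r * lo \<le> card {y \<in> S. y \<le> v}"
    using represents_le[OF rep fin, of v] unfolding img by (meson le_trans mult_le_mono1)
  have "g + 1 - r = card (M' ` {a + (r - 1)..<a + g})"
    using r by (subst card_image[OF inj_on_subset[OF inj]]) auto
  also have "\<dots> \<le> card {y \<in> M' ` {a..<a + g}. v \<le> y}"
    using r srt unfolding v_def by (intro card_mono) auto
  finally show "(g + 1 - r) * hi \<le> card {y \<in> S. v \<le> y}"
    using represents_ge[OF rep fin, of v] unfolding img by (meson le_trans mult_le_mono1)
qed

section \<open>Grouping steps carried out in memory\<close>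

lemma median_rank_bounds:
  assumes "0 < g"
  shows "1 \<le> median_rank g d" "median_rank g d \<le> g"
  using assms by (cases d; auto)+

lemma blocks_disjoint:
  assumes "t \<noteq> u"
  shows "{a + t * g..<a + t * g + g} \<inter> {a + u * g..<a + u * g + g} = ({} :: nat set)"
proof -
  have "p * g + g \<le> q * g" if "p < q" for p q :: nat
    using mult_le_mono1[of "Suc p" q g] that by simp
  from this[of t u] this[of u t] show ?thesis using assms by (cases "t < u") auto
qed

text \<open>The number of groups is bounded crudely by \<open>n\<close>. Besides sorting, an
  iteration costs 15 for copying the median and advancing, and 6 for the test; the 14 is the set-up
  (8) and the failing test (6).\<close>

definition group_time :: "nat \<Rightarrow> nat \<Rightarrow> nat" where
  "group_time g n = n * (sort_time g + 21) + 14"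

lemma group_time_mono: "m \<le> n \<Longrightarrow> group_time g m \<le> group_time g n"
  unfolding group_time_def by (intro add_mono mult_mono) auto

text \<open>One statement for a source before \<open>f\<close> and for a source starting at
  \<open>f\<close>, where the medians overwrite it. In the second case the source is not preserved,
  so the claim about its image is restricted to the first. The bound \<open>yn\<close> keeps the
  scratch cell \<open>f + n\<close> outside the source.\<close>

lemma runs_group_medians:
  fixes M :: "nat \<Rightarrow> 'a::linorder"
  assumes g: "0 < g" and xy: "x \<noteq> ''p''" "y \<noteq> ''p''"
    and af: "s x + s y \<le> s ''f'' \<or> s x = s ''f''"
    and yn: "s y \<le> s ''n''"
    and rep: "represents M (s x) (s y) S lo hi" and fin: "finite S"
    and T: "group_time g (s y) \<le> T"
    and Q: "\<And>s' M'. \<lbrakk>\<forall>z. z \<notin> {''p'', ''e'', ''k'', ''j'', ''l''} \<longrightarrow> s' z = s z;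
        s' ''k'' = s y div g;
        represents M' (s ''f'') (s y div g) S
          (median_rank g d * lo) ((g + 1 - median_rank g d) * hi);
        \<forall>c. c < s ''f'' \<and> c \<notin> {s x..<s x + s y} \<longrightarrow> M' c = M c;
        s x + s y \<le> s ''f'' \<longrightarrow> M' ` {s x..<s x + s y} = M ` {s x..<s x + s y}\<rbrakk>
      \<Longrightarrow> Q (s', M')"
  shows "runs P (group_medians g d (V x) (V y)) (s, M) T Q"
proof -
  define a where "a = s x"
  define L where "L = s y"
  define f where "f = s ''f''"
  define n where "n = s ''n''"
  define r where "r = median_rank g d"
  have r: "1 \<le> r" "r \<le> g" using median_rank_bounds[OF g] unfolding r_def by auto
  have af': "a + L \<le> f \<or> a = f" and Ln: "L \<le> n"
    using af yn unfolding a_def L_def f_def n_def by auto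
  then have aLf: "a + L \<le> f + n" "a \<le> f" by auto
  obtain B where disj: "disjoint_family_on B {a..<a + L}"
    and B: "\<And>c. c \<in> {a..<a + L} \<Longrightarrow> finite (B c) \<and> B c \<subseteq> S \<and> M c \<in> B c \<and>
      lo \<le> card {y \<in> B c. y \<le> M c} \<and> hi \<le> card {y \<in> B c. M c \<le> y}"
    using rep unfolding represents_def a_def L_def by blast
  \<comment> \<open>The new block of the \<open>t\<close>th median is the union of the blocks of its
    group. Unprocessed groups still have their initial contents under the invariant below, so blocks
    chosen for the initial memory serve throughout.\<close>
  define U where "U = (\<lambda>t. \<Union>c\<in>{a + t * g..<a + t * g + g}. B c)"
  define good where "good = (\<lambda>t v. v \<in> U t \<and> r * lo \<le> card {y \<in> U t. y \<le> v} \<and>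
      (g + 1 - r) * hi \<le> card {y \<in> U t. v \<le> y})"
  define I where "I = (\<lambda>(s', M'). (\<forall>z. z \<notin> {''p'', ''e'', ''k'', ''j'', ''l''} \<longrightarrow> s' z = s z) \<and>
      s' ''e'' = a + L \<and> s' ''p'' = a + s' ''k'' * g \<and> s' ''k'' * g \<le> L \<and>
      (\<forall>c\<in>{a + s' ''k'' * g..<a + L}. M' c = M c) \<and>
      (\<forall>c. c < f \<and> c \<notin> {a..<a + L} \<longrightarrow> M' c = M c) \<and>
      (a + L \<le> f \<longrightarrow> M' ` {a..<a + s' ''k'' * g} = M ` {a..<a + s' ''k'' * g}) \<and>
      (\<forall>t < s' ''k''. good t (M' (f + t))))"
  have block: "{a + t * g..<a + t * g + g} \<subseteq> {a..<a + L}" if "t * g + g \<le> L" for t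
    using that by auto
  have rep_block: "represents M (a + t * g) g (U t) lo hi" if "t * g + g \<le> L" for t
    unfolding represents_def
  proof (intro exI[of _ B] conjI)
    show "disjoint_family_on B {a + t * g..<a + t * g + g}"
      using disj block[OF that] unfolding disjoint_family_on_def by blast
  qed (use B block[OF that] in \<open>auto simp: U_def\<close>)
  have finU: "finite (U t)" and US: "U t \<subseteq> S" if "t * g + g \<le> L" for t
    unfolding U_def using B block[OF that] by blast+
  have "runs P (WHILE Less (V ''p'' \<oplus> N (g - 1)) (V ''e'') DO (
      insertion_sort (V ''p'') (V ''p'' \<oplus> N g);;
      Move (V ''f'' \<oplus> V ''k'') (V ''p'' \<oplus> N (median_rank g d - 1));;
      ''k'' ::= V ''k'' \<oplus> N 1;;
      ''p'' ::= V ''p'' \<oplus> N g)) (s(''p'' := a, ''e'' := a + L, ''k'' := 0), M) (T - 8) Q"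
  proof (rule runs_While[where I = I and C = "sort_time g + 15" and v = "\<lambda>(s', M'). a + L - s' ''p''"])
    show "I (s(''p'' := a, ''e'' := a + L, ''k'' := 0), M)" unfolding I_def by simp
  next
    fix \<sigma> :: "'a state"
    assume I: "I \<sigma>" and b: "bval (Less (V ''p'' \<oplus> N (g - 1)) (V ''e'')) \<sigma>"
    obtain s1 M1 where \<sigma>: "\<sigma> = (s1, M1)" by fastforce
    define k where "k = s1 ''k''"
    define p where "p = a + k * g"
    from I have s1: "\<And>z. z \<notin> {''p'', ''e'', ''k'', ''j'', ''l''} \<Longrightarrow> s1 z = s z"
      and s1e: "s1 ''e'' = a + L" and s1p: "s1 ''p'' = p"
      and rest: "\<And>c. c \<in> {p..<a + L} \<Longrightarrow> M1 c = M c"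
      and frame: "\<And>c. c < f \<Longrightarrow> c \<notin> {a..<a + L} \<Longrightarrow> M1 c = M c"
      and img: "a + L \<le> f \<Longrightarrow> M1 ` {a..<p} = M ` {a..<p}"
      and meds: "\<And>t. t < k \<Longrightarrow> good t (M1 (f + t))"
      unfolding \<sigma> I_def p_def k_def by auto
    have s1fn: "s1 ''f'' = f" "s1 ''n'' = n" using s1 unfolding f_def n_def by auto
    have kg: "k * g + g \<le> L" using b g s1e s1p unfolding \<sigma> p_def by auto
    have kkg: "k \<le> k * g" using g by simp
    have kL: "k < L" using kg kkg g by linarith
    show "runs P (insertion_sort (V ''p'') (V ''p'' \<oplus> N g);;
      Move (V ''f'' \<oplus> V ''k'') (V ''p'' \<oplus> N (median_rank g d - 1));;
      ''k'' ::= V ''k'' \<oplus> N 1;;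
      ''p'' ::= V ''p'' \<oplus> N g) \<sigma> (sort_time g + 15)
      (\<lambda>\<sigma>'. I \<sigma>' \<and> (case \<sigma>' of (s', M') \<Rightarrow> a + L - s' ''p'') < (case \<sigma> of (s', M') \<Rightarrow> a + L - s' ''p''))"
      unfolding \<sigma>
    proof (rule runs_Seq[where R = "\<lambda>(s2, M2). (\<forall>x. x \<notin> {''j'', ''l''} \<longrightarrow> s2 x = s1 x) \<and>
        (\<forall>c. c \<notin> {p..<p + g} \<and> c \<noteq> f + n \<longrightarrow> M2 c = M1 c) \<and>
        M2 ` {p..<p + g} = M1 ` {p..<p + g} \<and>
        (\<forall>c d. p \<le> c \<and> c \<le> d \<and> d < p + g \<longrightarrow> M2 c \<le> M2 d)"])
      show "runs P (insertion_sort (V ''p'') (V ''p'' \<oplus> N g)) (s1, M1) (sort_time g)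
        (\<lambda>(s2, M2). (\<forall>x. x \<notin> {''j'', ''l''} \<longrightarrow> s2 x = s1 x) \<and>
        (\<forall>c. c \<notin> {p..<p + g} \<and> c \<noteq> f + n \<longrightarrow> M2 c = M1 c) \<and>
        M2 ` {p..<p + g} = M1 ` {p..<p + g} \<and>
        (\<forall>c d. p \<le> c \<and> c \<le> d \<and> d < p + g \<longrightarrow> M2 c \<le> M2 d))"
        by (rule runs_insertion_sort[where a = p and w = g])
          (use s1p s1fn kg aLf in \<open>simp_all add: p_def\<close>)
      show "sort_time g \<le> sort_time g + 15" by simp
    next
      fix \<sigma>2 :: "'a state"
      assume *: "case \<sigma>2 of (s2, M2) \<Rightarrow> (\<forall>x. x \<notin> {''j'', ''l''} \<longrightarrow> s2 x = s1 x) \<and>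
        (\<forall>c. c \<notin> {p..<p + g} \<and> c \<noteq> f + n \<longrightarrow> M2 c = M1 c) \<and>
        M2 ` {p..<p + g} = M1 ` {p..<p + g} \<and>
        (\<forall>c d. p \<le> c \<and> c \<le> d \<and> d < p + g \<longrightarrow> M2 c \<le> M2 d)"
      obtain s2 M2 where \<sigma>2: "\<sigma>2 = (s2, M2)" by fastforce
      have s2: "\<And>x. x \<notin> {''j'', ''l''} \<Longrightarrow> s2 x = s1 x"
        and out: "\<And>c. c \<notin> {p..<p + g} \<Longrightarrow> c \<noteq> f + n \<Longrightarrow> M2 c = M1 c"
        and img2: "M2 ` {p..<p + g} = M1 ` {p..<p + g}"
        and srt: "\<And>c d. p \<le> c \<Longrightarrow> c \<le> d \<Longrightarrow> d < p + g \<Longrightarrow> M2 c \<le> M2 d"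
        using * unfolding \<sigma>2 by blast+
      define v where "v = M2 (p + (r - 1))"
      have img3: "M2 ` {p..<p + g} = M ` {p..<p + g}"
        unfolding img2 using rest kg by (intro image_cong) (auto simp: p_def)
      have good_k: "good k v"
        unfolding good_def v_def
        using represents_sorted[OF rep_block[OF kg] finU[OF kg], of M2 r] img3 srt r
        unfolding p_def by blast
      let ?s = "s2(''k'' := Suc k, ''p'' := p + g)"
      let ?M = "M2(f + k := v)"
      have out': "?M c = M1 c" if "c < f \<or> a + L \<le> f + n \<and> p + g \<le> c \<and> c < a + L" "c \<notin> {p..<p + g}" for c
      proof -
        \<comment> \<open>When source and target coincide, the median goes to \<open>f + k\<close>,
          before the end \<open>p + g\<close> of the current group: later groups stay intact, and
          the current one has already been read.\<close>
        have "k < k * g + g" using kkg g by linarith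
        then have "c \<noteq> f + k" using that(1) af' unfolding p_def by linarith
        then show ?thesis using that aLf out[of c] by auto
      qed
      \<comment> \<open>Medians stored earlier escape the sorting: they lie before the current group
        if the source starts at \<open>f\<close>, and beyond the whole source otherwise. The scratch
        cell is past them since \<open>k < L\<close> and \<open>L \<le> n\<close>.\<close>
      have old: "?M (f + t) = M1 (f + t)" if "t < k" for t
      proof -
        have "f + t < p \<or> p + g \<le> f + t"
          using af' kkg kg that unfolding p_def by linarith
        then have "f + t \<notin> {p..<p + g}" by auto
        then show ?thesis using that out[of "f + t"] kL Ln by simp
      qed
      have inv: "I (?s, ?M)"
      proof -
        have "\<forall>z. z \<notin> {''p'', ''e'', ''k'', ''j'', ''l''} \<longrightarrow> ?s z = s z"
          using s1 s2 by simp
        moreover have "?s ''e'' = a + L" using s1e s2 by simp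
        moreover have "?s ''p'' = a + ?s ''k'' * g" "?s ''k'' * g \<le> L"
          using kg by (auto simp: p_def)
        moreover have "?M c = M c" if "c \<in> {a + Suc k * g..<a + L}" for c
        proof -
          have "p + g \<le> c" "c < a + L" using that by (auto simp: p_def)
          then show ?thesis using out'[of c] rest[of c] aLf by simp
        qed
        moreover have "?M c = M c" if "c < f" "c \<notin> {a..<a + L}" for c
        proof -
          have "c \<notin> {p..<p + g}" using that kg by (auto simp: p_def)
          then show ?thesis using out'[of c] frame[of c] that by simp
        qed
        moreover have "?M ` {a..<a + Suc k * g} = M ` {a..<a + Suc k * g}" if "a + L \<le> f"
        proof -
          have split: "{a..<a + Suc k * g} = {a..<p} \<union> {p..<p + g}"
            unfolding p_def by auto
          have "?M ` {a..<p} = M1 ` {a..<p}"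
          proof (intro image_cong refl)
            fix c assume "c \<in> {a..<p}"
            then show "?M c = M1 c" using out'[of c] that kg unfolding p_def by simp
          qed
          moreover have "?M ` {p..<p + g} = M2 ` {p..<p + g}"
            using that kg by (intro image_cong) (auto simp: p_def)
          ultimately show ?thesis unfolding split image_Un using img[OF that] img3 by simp
        qed
        moreover have "good t (?M (f + t))" if "t < Suc k" for t
          using that good_k meds[of t] old[of t] by (cases "t = k") auto
        ultimately show ?thesis unfolding I_def by simp
      qed
      have "s2 ''f'' = f" "s2 ''k'' = k" "s2 ''p'' = p" using s2 s1fn s1p k_def by auto
      moreover have "a + L - (p + g) < a + L - p" using kg g unfolding p_def by linarith
      ultimately show "runs P (Move (V ''f'' \<oplus> V ''k'') (V ''p'' \<oplus> N (median_rank g d - 1));;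
        ''k'' ::= V ''k'' \<oplus> N 1;;
        ''p'' ::= V ''p'' \<oplus> N g) \<sigma>2 (sort_time g + 15 - sort_time g)
        (\<lambda>\<sigma>'. I \<sigma>' \<and> (case \<sigma>' of (s', M') \<Rightarrow> a + L - s' ''p'') <
          (case (s1, M1) of (s', M') \<Rightarrow> a + L - s' ''p''))"
        using inv s1p unfolding \<sigma>2 v_def r_def by simp
    qed
  next
    show "(case (s(''p'' := a, ''e'' := a + L, ''k'' := 0), M) of (s', M') \<Rightarrow> a + L - s' ''p'') *
        (sort_time g + 15 + bcost (Less (V ''p'' \<oplus> N (g - 1)) (V ''e'')) + 1) +
        bcost (Less (V ''p'' \<oplus> N (g - 1)) (V ''e'')) + 1 \<le> T - 8"
      using T unfolding group_time_def L_def[symmetric] by (simp add: algebra_simps)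
  next
    fix \<sigma> :: "'a state"
    assume I: "I \<sigma>" and b: "\<not> bval (Less (V ''p'' \<oplus> N (g - 1)) (V ''e'')) \<sigma>"
    obtain s1 M1 where \<sigma>: "\<sigma> = (s1, M1)" by fastforce
    define k where "k = s1 ''k''"
    from I have s1: "\<forall>z. z \<notin> {''p'', ''e'', ''k'', ''j'', ''l''} \<longrightarrow> s1 z = s z"
      and s1e: "s1 ''e'' = a + L" and s1p: "s1 ''p'' = a + k * g" and kgL: "k * g \<le> L"
      and rest: "\<And>c. c \<in> {a + k * g..<a + L} \<Longrightarrow> M1 c = M c"
      and frame: "\<forall>c. c < f \<and> c \<notin> {a..<a + L} \<longrightarrow> M1 c = M c"
      and img: "a + L \<le> f \<Longrightarrow> M1 ` {a..<a + k * g} = M ` {a..<a + k * g}"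
      and meds: "\<And>t. t < k \<Longrightarrow> good t (M1 (f + t))"
      unfolding \<sigma> I_def k_def by auto
    have "L < k * g + g" using b s1e s1p g unfolding \<sigma> by auto
    then have k: "k = L div g" using kgL
      by (intro div_nat_eqI[symmetric]) (auto simp: algebra_simps)
    have "represents M1 f k S (r * lo) ((g + 1 - r) * hi)"
      unfolding represents_def
    proof (intro exI[of _ "\<lambda>c. U (c - f)"] conjI)
      have le: "t * g + g \<le> L" if "t < k" for t
        using mult_le_mono1[of "Suc t" k g] that kgL by simp
      have U_disj: "U t \<inter> U u = {}" if "t < k" "u < k" "t \<noteq> u" for t u
      proof -
        have "B c \<inter> B c' = {}" if c: "c \<in> {a + t * g..<a + t * g + g}" "c' \<in> {a + u * g..<a + u * g + g}" for c c'
        proof -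
          have "c \<noteq> c'" using blocks_disjoint[OF \<open>t \<noteq> u\<close>, of a g] c by blast
          moreover have "c \<in> {a..<a + L}" "c' \<in> {a..<a + L}"
            using block[OF le[OF \<open>t < k\<close>]] block[OF le[OF \<open>u < k\<close>]] c by blast+
          ultimately show ?thesis using disj unfolding disjoint_family_on_def by blast
        qed
        then show ?thesis unfolding U_def by blast
      qed
      show "disjoint_family_on (\<lambda>c. U (c - f)) {f..<f + k}"
        unfolding disjoint_family_on_def
      proof (intro ballI impI)
        fix c c' assume "c \<in> {f..<f + k}" "c' \<in> {f..<f + k}" "c \<noteq> c'"
        then show "U (c - f) \<inter> U (c' - f) = {}" by (intro U_disj) auto
      qed
      have "finite (U (c - f)) \<and> U (c - f) \<subseteq> S \<and> good (c - f) (M1 c)" if "c \<in> {f..<f + k}" for c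
      proof -
        have ck: "c - f < k" "f + (c - f) = c" using that by auto
        then show ?thesis using meds[OF ck(1)] finU[OF le[OF ck(1)]] US[OF le[OF ck(1)]] by simp
      qed
      then show "\<forall>c\<in>{f..<f + k}. finite (U (c - f)) \<and> U (c - f) \<subseteq> S \<and> M1 c \<in> U (c - f) \<and>
          r * lo \<le> card {y \<in> U (c - f). y \<le> M1 c} \<and> (g + 1 - r) * hi \<le> card {y \<in> U (c - f). M1 c \<le> y}"
        unfolding good_def by blast
    qed
    moreover have "M1 ` {a..<a + L} = M ` {a..<a + L}" if "a + L \<le> f"
    proof -
      have split: "{a..<a + L} = {a..<a + k * g} \<union> {a + k * g..<a + L}" using kgL by auto
      have "M1 ` {a + k * g..<a + L} = M ` {a + k * g..<a + L}"
        using rest by (intro image_cong) auto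
      then show ?thesis unfolding split image_Un using img[OF that] by simp
    qed
    ultimately show "Q \<sigma>" unfolding \<sigma>
      using Q[OF s1] k frame unfolding k_def r_def a_def L_def f_def by simp
  qed
  moreover obtain T' where "T = 8 + T'"
    using T le_Suc_ex[of 8 T] unfolding group_time_def by auto
  ultimately show ?thesis using xy unfolding group_medians_def
    by (simp add: a_def L_def eval_nat_numeral)
qed


text \<open>Each pass multiplies both bounds by the factors of its median and divides the length by
  \<open>g\<close>; iterated floor divisions collapse into one by \<open>g ^ length ds\<close>.
  Every pass is charged as if it had length \<open>n\<close>, and the extra 1 pays for the closing
  \<open>SKIP\<close>.\<close>

lemma runs_repeat_grouping:
  fixes M :: "nat \<Rightarrow> 'a::linorder"
  assumes g: "0 < g" and kn: "s ''k'' \<le> s ''n''"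
    and rep: "represents M (s ''f'') (s ''k'') S lo hi" and fin: "finite S"
    and T: "length ds * group_time g (s ''n'') + 1 \<le> T"
    and Q: "\<And>s' M'. \<lbrakk>\<forall>z. z \<notin> {''p'', ''e'', ''k'', ''j'', ''l''} \<longrightarrow> s' z = s z;
        s' ''k'' = s ''k'' div g ^ length ds;
        represents M' (s ''f'') (s ''k'' div g ^ length ds) S
          ((\<Prod>d\<leftarrow>ds. median_rank g d) * lo) ((\<Prod>d\<leftarrow>ds. g + 1 - median_rank g d) * hi);
        \<forall>c < s ''f''. M' c = M c\<rbrakk> \<Longrightarrow> Q (s', M')"
  shows "runs P (repeat_grouping g ds) (s, M) T Q"
  using kn rep T Q
proof (induction ds arbitrary: s M lo hi T)
  case Nil
  then show ?case by simp
next
  case (Cons d ds)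
  note Q = Cons.prems(4)
  show ?case unfolding repeat_grouping.simps
  proof (rule runs_Seq[where ?T1.0 = "group_time g (s ''n'')" and R = "\<lambda>(s1, M1).
      (\<forall>z. z \<notin> {''p'', ''e'', ''k'', ''j'', ''l''} \<longrightarrow> s1 z = s z) \<and> s1 ''k'' = s ''k'' div g \<and>
      represents M1 (s ''f'') (s ''k'' div g) S
        (median_rank g d * lo) ((g + 1 - median_rank g d) * hi) \<and>
      (\<forall>c < s ''f''. M1 c = M c)"])
    show "runs P (group_medians g d (V ''f'') (V ''k'')) (s, M) (group_time g (s ''n'')) (\<lambda>(s1, M1).
      (\<forall>z. z \<notin> {''p'', ''e'', ''k'', ''j'', ''l''} \<longrightarrow> s1 z = s z) \<and> s1 ''k'' = s ''k'' div g \<and>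
      represents M1 (s ''f'') (s ''k'' div g) S
        (median_rank g d * lo) ((g + 1 - median_rank g d) * hi) \<and>
      (\<forall>c < s ''f''. M1 c = M c))"
      using Cons.prems(1,2) fin g group_time_mono
      by (intro runs_group_medians[where S = S and lo = lo and hi = hi]) auto
    show "group_time g (s ''n'') \<le> T" using Cons.prems(3) by simp
  next
    fix \<sigma>1 :: "'a state"
    assume *: "case \<sigma>1 of (s1, M1) \<Rightarrow>
      (\<forall>z. z \<notin> {''p'', ''e'', ''k'', ''j'', ''l''} \<longrightarrow> s1 z = s z) \<and> s1 ''k'' = s ''k'' div g \<and>
      represents M1 (s ''f'') (s ''k'' div g) S
        (median_rank g d * lo) ((g + 1 - median_rank g d) * hi) \<and>
      (\<forall>c < s ''f''. M1 c = M c)"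
    obtain s1 M1 where \<sigma>1: "\<sigma>1 = (s1, M1)" by fastforce
    from * have same: "\<And>z. z \<notin> {''p'', ''e'', ''k'', ''j'', ''l''} \<Longrightarrow> s1 z = s z"
      and k: "s1 ''k'' = s ''k'' div g"
      and rep1: "represents M1 (s ''f'') (s ''k'' div g) S
        (median_rank g d * lo) ((g + 1 - median_rank g d) * hi)"
      and frame: "\<And>c. c < s ''f'' \<Longrightarrow> M1 c = M c"
      unfolding \<sigma>1 by auto
    have fn: "s1 ''f'' = s ''f''" "s1 ''n'' = s ''n''" using same by auto
    show "runs P (repeat_grouping g ds) \<sigma>1 (T - group_time g (s ''n'')) Q"
      unfolding \<sigma>1
    proof (rule Cons.IH)
      show "s1 ''k'' \<le> s1 ''n''" using Cons.prems(1) div_le_dividend le_trans unfolding fn k by blast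
      show "represents M1 (s1 ''f'') (s1 ''k'') S
          (median_rank g d * lo) ((g + 1 - median_rank g d) * hi)"
        using rep1 unfolding fn k .
      show "length ds * group_time g (s1 ''n'') + 1 \<le> T - group_time g (s ''n'')"
        using Cons.prems(3) unfolding fn by simp
    next
      fix s2 and M2 :: "nat \<Rightarrow> 'a"
      assume 2: "\<forall>z. z \<notin> {''p'', ''e'', ''k'', ''j'', ''l''} \<longrightarrow> s2 z = s1 z"
        "s2 ''k'' = s1 ''k'' div g ^ length ds"
        "represents M2 (s1 ''f'') (s1 ''k'' div g ^ length ds) S
          ((\<Prod>d\<leftarrow>ds. median_rank g d) * (median_rank g d * lo))
          ((\<Prod>d\<leftarrow>ds. g + 1 - median_rank g d) * ((g + 1 - median_rank g d) * hi))"
        "\<forall>c < s1 ''f''. M2 c = M1 c"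
      have kk: "s1 ''k'' div g ^ length ds = s ''k'' div g ^ length (d # ds)"
        unfolding k by (simp add: div_mult2_eq)
      show "Q (s2, M2)"
      proof (rule Q)
        show "\<forall>z. z \<notin> {''p'', ''e'', ''k'', ''j'', ''l''} \<longrightarrow> s2 z = s z"
          using 2(1) same by simp
        show "s2 ''k'' = s ''k'' div g ^ length (d # ds)" using 2(2) kk by simp
        show "represents M2 (s ''f'') (s ''k'' div g ^ length (d # ds)) S
          ((\<Prod>d\<leftarrow>d # ds. median_rank g d) * lo) ((\<Prod>d\<leftarrow>d # ds. g + 1 - median_rank g d) * hi)"
          using 2(3) unfolding kk fn by (simp add: ac_simps del: median_rank.simps)
        show "\<forall>c < s ''f''. M2 c = M c" using 2(4) frame unfolding fn by simp
      qed
    qed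
  qed
qed


section \<open>Splitting the sequence at the pivot\<close>

section \<open>Partition\<close>

lemma Collect_image_atLeastLessThan_Suc:
  assumes "b \<le> p"
  shows "{y \<in> M ` {b..<Suc p}. R y} =
    (if R (M p) then insert (M p) {y \<in> M ` {b..<p}. R y} else {y \<in> M ` {b..<p}. R y})"
  using assms by (auto simp: atLeastLessThanSuc)

lemma card_filter_image_le:
  "card {y \<in> M ` {b..<p}. R y} \<le> p - (b :: nat)"
proof -
  have "card {y \<in> M ` {b..<p}. R y} \<le> card (M ` {b..<p})" by (intro card_mono) auto
  also have "\<dots> \<le> p - b" using card_image_le[of "{b..<p}" M] by simp
  finally show ?thesis .
qed

text \<open>An element costs at most 25, in the branch with two comparisons, plus 4 for the loop
  test; the 14 is the set-up (10) and the failing test (4). Counters are claimed to be cardinalities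
  of sets, which requires the distinctness in \<open>inj\<close>.\<close>

lemma runs_partition:
  fixes M :: "nat \<Rightarrow> 'a::linorder"
  defines "S \<equiv> \<lambda>s M. M ` {s ''b''..<s ''b'' + s ''n'' :: nat}"
  assumes bf: "s ''b'' + s ''n'' \<le> s ''f''" and inj: "inj_on M {s ''b''..<s ''b'' + s ''n''}"
    and T: "29 * s ''n'' + 14 \<le> T"
    and Q: "\<And>s' M'. \<lbrakk>\<forall>z. z \<notin> {''p'', ''e'', ''c1'', ''c2''} \<longrightarrow> s' z = s z;
        s' ''c1'' = card {y \<in> S s M. y < M (s ''f'')};
        s' ''c2'' = card {y \<in> S s M. M (s ''f'') < y};
        M' ` {s ''f'' + 1..<s ''f'' + 1 + s' ''c1''} = {y \<in> S s M. y < M (s ''f'')};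
        M' ` {s ''f'' + 1 + s ''n''..<s ''f'' + 1 + s ''n'' + s' ''c2''} = {y \<in> S s M. M (s ''f'') < y};
        \<forall>c \<le> s ''f''. M' c = M c\<rbrakk> \<Longrightarrow> Q (s', M')"
  shows "runs P partition_sequence (s, M) T Q"
proof -
  define b where "b = s ''b''"
  define n where "n = s ''n''"
  define f where "f = s ''f''"
  define v where "v = M f"
  define below where "below = (\<lambda>p. {y \<in> M ` {b..<p}. y < v})"
  define above where "above = (\<lambda>p. {y \<in> M ` {b..<p}. v < y})"
  define I where "I = (\<lambda>(s', M'). (\<forall>z. z \<notin> {''p'', ''e'', ''c1'', ''c2''} \<longrightarrow> s' z = s z) \<and>
      s' ''e'' = b + n \<and> b \<le> s' ''p'' \<and> s' ''p'' \<le> b + n \<and>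
      s' ''c1'' = card (below (s' ''p'')) \<and> s' ''c2'' = card (above (s' ''p'')) \<and>
      M' ` {f + 1..<f + 1 + s' ''c1''} = below (s' ''p'') \<and>
      M' ` {f + 1 + n..<f + 1 + n + s' ''c2''} = above (s' ''p'') \<and>
      (\<forall>c \<le> f. M' c = M c))"
  have bf': "b + n \<le> f" using bf unfolding b_def n_def f_def .
  have "runs P (WHILE Less (V ''p'') (V ''e'') DO (
      IF Elem_Less (V ''p'') (V ''f'')
      THEN (Move (V ''f'' \<oplus> N 1 \<oplus> V ''c1'') (V ''p'');; ''c1'' ::= V ''c1'' \<oplus> N 1)
      ELSE (IF Elem_Less (V ''f'') (V ''p'')
            THEN (Move (V ''f'' \<oplus> N 1 \<oplus> V ''n'' \<oplus> V ''c2'') (V ''p'');; ''c2'' ::= V ''c2'' \<oplus> N 1)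
            ELSE SKIP);;
      ''p'' ::= V ''p'' \<oplus> N 1))
    (s(''p'' := b, ''e'' := b + n, ''c1'' := 0, ''c2'' := 0), M) (T - 10) Q"
  proof (rule runs_While[where I = I and C = 25 and v = "\<lambda>(s', M'). b + n - s' ''p''"])
    show "I (s(''p'' := b, ''e'' := b + n, ''c1'' := 0, ''c2'' := 0), M)"
      unfolding I_def below_def above_def by simp
  next
    fix \<sigma> :: "'a state"
    assume I: "I \<sigma>" and less: "bval (Less (V ''p'') (V ''e'')) \<sigma>"
    obtain s1 M1 where \<sigma>: "\<sigma> = (s1, M1)" by fastforce
    define p where "p = s1 ''p''"
    define k1 where "k1 = s1 ''c1''"
    define k2 where "k2 = s1 ''c2''"
    from I have s1: "\<And>z. z \<notin> {''p'', ''e'', ''c1'', ''c2''} \<Longrightarrow> s1 z = s z"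
      and s1e: "s1 ''e'' = b + n" and bp: "b \<le> p"
      and k1: "k1 = card (below p)" and k2: "k2 = card (above p)"
      and im1: "M1 ` {f + 1..<f + 1 + k1} = below p"
      and im2: "M1 ` {f + 1 + n..<f + 1 + n + k2} = above p"
      and frame: "\<And>c. c \<le> f \<Longrightarrow> M1 c = M c"
      unfolding \<sigma> I_def p_def k1_def k2_def prod.case by blast+
    have s1': "s1 ''f'' = f" "s1 ''n'' = n" using s1 unfolding f_def n_def by auto
    have pn: "p < b + n" using less s1e unfolding \<sigma> p_def by simp
    \<comment> \<open>Fewer than \<open>n\<close> elements have been seen, so the next cell
      \<open>f + 1 + k1\<close> lies below the start \<open>f + 1 + n\<close> of the area for larger
      elements.\<close>
    have k1n: "k1 < n"
      using card_filter_image_le[of M b p "\<lambda>y. y < v"] pn bp unfolding k1 below_def by linarith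
    have new: "M p \<notin> M ` {b..<p}"
      using inj pn bp unfolding inj_on_def b_def n_def by fastforce
    have fin: "finite (below p)" "finite (above p)" unfolding below_def above_def by auto
    have M1p: "M1 p = M p" "M1 f = v" using frame pn bf' unfolding v_def by auto
    have below_Suc: "below (Suc p) = (if M p < v then insert (M p) (below p) else below p)"
      and above_Suc: "above (Suc p) = (if v < M p then insert (M p) (above p) else above p)"
      unfolding below_def above_def using bp
      by (simp_all only: Collect_image_atLeastLessThan_Suc[where R = "\<lambda>y. y < v"]
          Collect_image_atLeastLessThan_Suc[where R = "\<lambda>y. v < y"])
    have cards: "card (insert (M p) (below p)) = Suc k1" "card (insert (M p) (above p)) = Suc k2"
      using new fin unfolding k1 k2 below_def above_def by auto
    have other: "s1 z = s z" if "z \<noteq> ''p''" "z \<noteq> ''e''" "z \<noteq> ''c1''" "z \<noteq> ''c2''" for z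
      using s1 that by simp
    consider (lt) "M p < v" | (gt) "v < M p" | (eq) "M p = v" by fastforce
    then show "runs P (
        IF Elem_Less (V ''p'') (V ''f'')
        THEN (Move (V ''f'' \<oplus> N 1 \<oplus> V ''c1'') (V ''p'');; ''c1'' ::= V ''c1'' \<oplus> N 1)
        ELSE (IF Elem_Less (V ''f'') (V ''p'')
              THEN (Move (V ''f'' \<oplus> N 1 \<oplus> V ''n'' \<oplus> V ''c2'') (V ''p'');; ''c2'' ::= V ''c2'' \<oplus> N 1)
              ELSE SKIP);;
        ''p'' ::= V ''p'' \<oplus> N 1) \<sigma> 25
      (\<lambda>\<sigma>'. I \<sigma>' \<and> (case \<sigma>' of (s', M') \<Rightarrow> b + n - s' ''p'') < (case \<sigma> of (s', M') \<Rightarrow> b + n - s' ''p''))"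
    proof cases
      case lt
      let ?M = "M1(f + 1 + k1 := M p)"
      have "{f + 1..<f + 1 + Suc k1} = insert (f + 1 + k1) {f + 1..<f + 1 + k1}" by auto
      then have "?M ` {f + 1..<f + 1 + Suc k1} = insert (M p) (below p)"
        unfolding im1[symmetric] by auto
      moreover have "?M ` {f + 1 + n..<f + 1 + n + k2} = above p"
        unfolding im2[symmetric] using k1n by (intro image_cong) auto
      ultimately have "I (s1(''c1'' := Suc k1, ''p'' := Suc p), ?M)"
        unfolding I_def using lt bp pn s1e cards k2 frame other
        by (simp add: below_Suc above_Suc k2_def[symmetric])
      then show ?thesis
        using lt pn M1p s1' unfolding \<sigma> by (simp add: p_def[symmetric] k1_def[symmetric] diff_less_mono2)
    next
      case gt
      let ?M = "M1(f + 1 + n + k2 := M p)"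
      have "{f + 1 + n..<f + 1 + n + Suc k2} = insert (f + 1 + n + k2) {f + 1 + n..<f + 1 + n + k2}"
        by auto
      then have "?M ` {f + 1 + n..<f + 1 + n + Suc k2} = insert (M p) (above p)"
        unfolding im2[symmetric] by auto
      moreover have "?M ` {f + 1..<f + 1 + k1} = below p"
        unfolding im1[symmetric] using k1n by (intro image_cong) auto
      ultimately have "I (s1(''c2'' := Suc k2, ''p'' := Suc p), ?M)"
        unfolding I_def using gt bp pn s1e cards k1 frame other
        by (simp add: below_Suc above_Suc k1_def[symmetric])
      then show ?thesis
        using gt pn M1p s1' unfolding \<sigma> by (simp add: p_def[symmetric] k2_def[symmetric] diff_less_mono2)
    next
      case eq
      have "I (s1(''p'' := Suc p), M1)"
        unfolding I_def using eq bp pn s1e k1 k2 im1 im2 frame other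
        by (simp add: below_Suc above_Suc k1_def[symmetric] k2_def[symmetric])
      then show ?thesis
        using eq pn M1p s1' unfolding \<sigma> by (simp add: p_def[symmetric] diff_less_mono2)
    qed
  next
    show "(case (s(''p'' := b, ''e'' := b + n, ''c1'' := 0, ''c2'' := 0), M) of (s', M') \<Rightarrow> b + n - s' ''p'') *
        (25 + bcost (Less (V ''p'') (V ''e'')) + 1) + bcost (Less (V ''p'') (V ''e'')) + 1 \<le> T - 10"
      using T by (simp add: n_def)
  next
    fix \<sigma> :: "'a state"
    assume I: "I \<sigma>" and ge: "\<not> bval (Less (V ''p'') (V ''e'')) \<sigma>"
    obtain s1 M1 where \<sigma>: "\<sigma> = (s1, M1)" by fastforce
    have p: "s1 ''p'' = b + n" using I ge unfolding \<sigma> I_def by simp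
    note I' = I[unfolded \<sigma> I_def prod.case p, unfolded below_def above_def v_def b_def n_def f_def]
    then show "Q \<sigma>" unfolding \<sigma> by (elim conjE) (rule Q[unfolded S_def])
  qed
  moreover obtain T' where "T = 10 + T'" using T le_Suc_ex[of 10 T] by auto
  ultimately show ?thesis unfolding partition_sequence_def
    by (simp add: b_def n_def eval_nat_numeral)
qed


section \<open>Ranks in finite sets, and the quality of the pivot\<close>

section \<open>Ranks\<close>

text \<open>Ranks are taken in sets rather than in sorted lists, to fit specifications that describe
  memory by images. Lists return only in the final comparison with \<open>sort A\<close>.\<close>

definition ith_smallest :: "nat \<Rightarrow> 'a::linorder set \<Rightarrow> 'a \<Rightarrow> bool" where
  "ith_smallest i S x \<longleftrightarrow> x \<in> S \<and> Suc (card {y \<in> S. y < x}) = i"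

lemma ith_smallest_sorted:
  fixes M :: "nat \<Rightarrow> 'a::linorder"
  assumes inj: "inj_on M {a..<a + n}"
    and srt: "\<And>c d. a \<le> c \<Longrightarrow> c \<le> d \<Longrightarrow> d < a + n \<Longrightarrow> M c \<le> M d"
    and i: "1 \<le> i" "i \<le> n"
  shows "ith_smallest i (M ` {a..<a + n}) (M (a + i - 1))"
proof -
  have less: "M c < M (a + i - 1) \<longleftrightarrow> c < a + i - 1" if "c \<in> {a..<a + n}" for c
  proof (cases "c < a + i - 1")
    case True
    moreover have "a + i - 1 \<in> {a..<a + n}" using i by auto
    ultimately have "M c \<noteq> M (a + i - 1)" using inj_onD[OF inj, of c "a + i - 1"] that by auto
    then show ?thesis using True srt[of c "a + i - 1"] that i by force
  next
    case False
    then show ?thesis using srt[of "a + i - 1" c] that i by force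
  qed
  have "card {y \<in> M ` {a..<a + n}. y < M (a + i - 1)} = card {c \<in> {a..<a + n}. M c < M (a + i - 1)}"
    by (rule card_filter_image[OF inj])
  also have "{c \<in> {a..<a + n}. M c < M (a + i - 1)} = {a..<a + i - 1}"
    using less i by auto
  finally have "Suc (card {y \<in> M ` {a..<a + n}. y < M (a + i - 1)}) = i" using i by simp
  moreover have "M (a + i - 1) \<in> M ` {a..<a + n}" using i by (intro imageI) auto
  ultimately show ?thesis unfolding ith_smallest_def by blast
qed

text \<open>If \<open>x < y\<close> then \<open>x\<close> is counted below \<open>y\<close> but not
  below itself, so the two counts differ.\<close>

lemma ith_smallest_unique:
  assumes "ith_smallest i S x" "ith_smallest i S y" "finite S"
  shows "x = y"
proof -
  have False if xy: "ith_smallest i S x" "ith_smallest i S y" "x < y" for x y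
  proof -
    have "{z \<in> S. z < x} \<subset> {z \<in> S. z < y}" using xy unfolding ith_smallest_def by auto
    then have "card {z \<in> S. z < x} < card {z \<in> S. z < y}"
      using assms(3) by (intro psubset_card_mono) auto
    then show False using xy unfolding ith_smallest_def by linarith
  qed
  then show ?thesis using assms by (metis neqE)
qed

lemma ith_smallest_sort_nth:
  assumes "distinct A" "1 \<le> i" "i \<le> length A"
  shows "ith_smallest i (set A) (sort A ! (i - 1))"
proof -
  have "set A = (!) (sort A) ` {0..<0 + length A}"
    by (simp add: nth_image[of "length A" "sort A", simplified] atLeast0LessThan[symmetric])
  moreover have "ith_smallest i ((!) (sort A) ` {0..<0 + length A}) (sort A ! (0 + i - 1))"
    using assms by (intro ith_smallest_sorted)
      (auto simp: inj_on_def nth_eq_iff_index_eq intro: sorted_nth_mono)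
  ultimately show ?thesis by simp
qed

lemma ith_smallest_below:
  assumes "ith_smallest i {y \<in> S. y < v} x"
  shows "ith_smallest i S x"
proof -
  have "{z \<in> {y \<in> S. y < v}. z < x} = {z \<in> S. z < x}"
    using assms unfolding ith_smallest_def by auto
  then show ?thesis using assms unfolding ith_smallest_def by simp
qed

text \<open>Below \<open>x\<close> lie also \<open>v\<close> and everything under \<open>v\<close>;
  these account for the shift that the program undoes by subtracting \<open>c1\<close> and 1 from
  \<open>i\<close>. In \<open>ith_smallest_below\<close> nothing under \<open>x\<close> is lost, so
  the rank is unchanged.\<close>

lemma ith_smallest_above:
  assumes "ith_smallest i {y \<in> S. v < y} x" "v \<in> S" "finite S"
  shows "ith_smallest (i + card {y \<in> S. y < v} + 1) S x"
proof -
  have "{z \<in> S. z < x} = {z \<in> {y \<in> S. v < y}. z < x} \<union> insert v {y \<in> S. y < v}"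
    using assms unfolding ith_smallest_def by force
  moreover have "card ({z \<in> {y \<in> S. v < y}. z < x} \<union> insert v {y \<in> S. y < v}) =
      card {z \<in> {y \<in> S. v < y}. z < x} + card (insert v {y \<in> S. y < v})"
    using assms(3) by (intro card_Un_disjoint) auto
  ultimately show ?thesis using assms unfolding ith_smallest_def by simp
qed

lemma card_split_at:
  fixes v :: "'a::linorder"
  assumes "v \<in> S" "finite S"
  shows "card {y \<in> S. y < v} + card {y \<in> S. v < y} + 1 = card S"
    and "card {y \<in> S. y \<le> v} = Suc (card {y \<in> S. y < v})"
    and "card {y \<in> S. v \<le> y} = Suc (card {y \<in> S. v < y})"
proof -
  have le: "{y \<in> S. y \<le> v} = insert v {y \<in> S. y < v}"
    and ge: "{y \<in> S. v \<le> y} = insert v {y \<in> S. v < y}" using assms by auto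
  show 1: "card {y \<in> S. y \<le> v} = Suc (card {y \<in> S. y < v})"
    unfolding le using assms by simp
  show "card {y \<in> S. v \<le> y} = Suc (card {y \<in> S. v < y})"
    unfolding ge using assms by simp
  have "S = {y \<in> S. y \<le> v} \<union> {y \<in> S. v < y}" by auto
  moreover have "card ({y \<in> S. y \<le> v} \<union> {y \<in> S. v < y}) = card {y \<in> S. y \<le> v} + card {y \<in> S. v < y}"
    using assms by (intro card_Un_disjoint) auto
  ultimately show "card {y \<in> S. y < v} + card {y \<in> S. v < y} + 1 = card S" using 1 by simp
qed

text \<open>Of the \<open>k\<close> representatives, \<open>(k + 1) div 2\<close> are at or below
  \<open>v\<close> and \<open>k + 1 - (k + 1) div 2\<close> at or above it, each at least half of
  \<open>k\<close>. Each stands for 3 or more elements on its side, which are lost to the opposite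
  side. Doubling the inequalities avoids a fraction.\<close>

lemma median_of_representatives:
  assumes rep: "represents M a k S lo hi" and fin: "finite S"
    and lo: "3 \<le> lo" and hi: "3 \<le> hi"
    and med: "ith_smallest ((k + 1) div 2) (M ` {a..<a + k}) v"
  shows "v \<in> S"
    and "2 * card {y \<in> S. y < v} + 3 * k \<le> 2 * card S"
    and "2 * card {y \<in> S. v < y} + 3 * k \<le> 2 * card S"
proof -
  let ?V = "M ` {a..<a + k}"
  have v: "v \<in> ?V" "Suc (card {y \<in> ?V. y < v}) = (k + 1) div 2"
    using med unfolding ith_smallest_def by auto
  show vS: "v \<in> S" using v(1) represents_subset[OF rep] by blast
  have "card ?V = k" using card_image[OF represents_inj_on[OF rep]] by simp
  then have V: "card {y \<in> ?V. y \<le> v} = (k + 1) div 2" "card {y \<in> ?V. v \<le> y} = k + 1 - (k + 1) div 2"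
    using card_split_at[OF v(1)] v(2) by auto
  have "(k + 1) div 2 * 3 \<le> (k + 1) div 2 * lo"
    and "(k + 1 - (k + 1) div 2) * 3 \<le> (k + 1 - (k + 1) div 2) * hi"
    using lo hi by simp_all
  then have "(k + 1) div 2 * 3 \<le> Suc (card {y \<in> S. y < v})"
    and "(k + 1 - (k + 1) div 2) * 3 \<le> Suc (card {y \<in> S. v < y})"
    using represents_le[OF rep fin, of v] represents_ge[OF rep fin, of v]
    unfolding V card_split_at[OF vS fin] by linarith+
  then show "2 * card {y \<in> S. y < v} + 3 * k \<le> 2 * card S"
    and "2 * card {y \<in> S. v < y} + 3 * k \<le> 2 * card S"
    using card_split_at(1)[OF vS fin] by linarith+
qed


section \<open>One iteration, the recurrence, and the induction on the length\<close>

section \<open>Selection\<close>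

definition select_step :: "nat \<Rightarrow> nat \<Rightarrow> median \<Rightarrow> median list \<Rightarrow> com" where
  "select_step g n0 d ds =
      (IF Less (V ''n'') (N (n0 + 1))
      THEN (
        insertion_sort (V ''b'') (V ''b'' \<oplus> V ''n'');;
        ''r'' ::= V ''b'' \<oplus> V ''i'' \<ominus> N 1;;
        ''done'' ::= N 1)
      ELSE (
        group_medians g d (V ''b'') (V ''n'');;
        repeat_grouping g ds;;
        Call ''m'' [(''b'', V ''f''), (''n'', V ''k''), (''i'', Half (V ''k'' \<oplus> N 1)),
                    (''f'', V ''f'' \<oplus> V ''k'')];;
        Move (V ''f'') (V ''m'');;
        partition_sequence;;
        IF Equal (V ''c1'') (V ''i'' \<ominus> N 1)
        THEN (
          ''r'' ::= V ''f'';;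
          ''done'' ::= N 1)
        ELSE (
          ''e'' ::= V ''f'' \<oplus> N 1 \<oplus> V ''n'' \<oplus> V ''n'';;
          IF Less (V ''i'' \<ominus> N 1) (V ''c1'')
          THEN (
            ''b'' ::= V ''f'' \<oplus> N 1;;
            ''n'' ::= V ''c1'')
          ELSE (
            ''b'' ::= V ''f'' \<oplus> N 1 \<oplus> V ''n'';;
            ''n'' ::= V ''c2'';;
            ''i'' ::= V ''i'' \<ominus> V ''c1'' \<ominus> N 1);;
          ''f'' ::= V ''e'')))"

lemma grouping_select_eq:
  "grouping_select g n0 d ds =
    ''done'' ::= N 0 ;; WHILE Equal (V ''done'') (N 0) DO select_step g n0 d ds"
  unfolding grouping_select_def select_step_def ..

definition step_factor :: "nat \<Rightarrow> nat \<Rightarrow> nat" where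
  "step_factor g m = Suc m * (sort_time g + 35) + 129"

text \<open>An iteration outside its recursive call costs at most
  \<open>step_factor g m * n\<close>. The recurrence leaves a surplus of half of \<open>k\<close>
  times the factor, and \<open>n \<le> 2 * g ^ Suc m * k\<close>; hence the 4. The remaining
  summands pay for sorting a short sequence.\<close>

definition select_factor :: "nat \<Rightarrow> nat \<Rightarrow> nat \<Rightarrow> nat" where
  "select_factor g n0 m = 4 * g ^ Suc m * step_factor g m + sort_time n0 + 20"

text \<open>The induction step of the linear bound: recursive call, remaining sequence and local
  work together stay within the factor times \<open>n\<close>. All additive constants are absorbed
  using \<open>1 \<le> n\<close>.\<close>

lemma select_factor_recurrence:
  assumes g: "0 < g" and n: "g ^ Suc m \<le> n" and k: "k = n div g ^ Suc m"
    and n': "2 * n' + 3 * k \<le> 2 * n"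
  shows "select_factor g n0 m * k + select_factor g n0 m * n' +
      (Suc m * group_time g n + 29 * n + 100) \<le> select_factor g n0 m * n"
proof -
  let ?G = "g ^ Suc m" and ?K = "select_factor g n0 m" and ?C = "step_factor g m"
  have G: "0 < ?G" using g by simp
  have n1: "1 \<le> n" using n G by linarith
  have "Suc m * group_time g n \<le> Suc m * (n * (sort_time g + 35))"
    using n1 unfolding group_time_def by (intro mult_left_mono) (auto simp: algebra_simps)
  then have "Suc m * group_time g n + 29 * n + 100 \<le> ?C * n"
    using n1 unfolding step_factor_def by (simp add: algebra_simps)
  \<comment> \<open>Rounding down in \<open>k\<close> costs at most a factor 2, because
    \<open>k\<close> is at least 1.\<close>
  moreover have "n \<le> 2 * ?G * k"
  proof -
    have "1 \<le> k" using n G unfolding k by (simp add: Suc_le_eq div_greater_zero_iff)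
    have "n < ?G * k + ?G" using dividend_less_times_div[OF G, of n] unfolding k by simp
    moreover have "?G * 1 \<le> ?G * k" using \<open>1 \<le> k\<close> by (intro mult_left_mono) auto
    moreover have "2 * ?G * k = ?G * k + ?G * k" by (simp add: mult.assoc)
    ultimately show ?thesis by linarith
  qed
  then have "?C * n \<le> ?C * (2 * ?G * k)" by simp
  then have "2 * (?C * n) \<le> (4 * ?G * ?C) * k" by (simp add: mult_ac)
  moreover have "(4 * ?G * ?C) * k \<le> ?K * k"
    unfolding select_factor_def by (intro mult_right_mono) auto
  moreover have "?K * (2 * n' + 3 * k) \<le> ?K * (2 * n)" using n' by (intro mult_left_mono) auto
  then have "2 * (?K * n') + 3 * (?K * k) \<le> 2 * (?K * n)" by (simp add: algebra_simps)
  ultimately show ?thesis by linarith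
qed

text \<open>The clause on cells below \<open>b\<close> is what the induction needs: a call working
  on the medians from \<open>f\<close> on must leave the caller's sequence below \<open>f\<close>
  intact. The bound on \<open>n0\<close> ensures that at least one median remains whenever the
  sequence is not sorted directly.\<close>

lemma runs_grouping_select:
  fixes M :: "nat \<Rightarrow> 'a::linorder"
  assumes g: "2 \<le> g" and n0: "g ^ Suc (length ds) \<le> n0"
    and lo: "3 \<le> (\<Prod>d\<leftarrow>d # ds. median_rank g d)"
    and hi: "3 \<le> (\<Prod>d\<leftarrow>d # ds. g + 1 - median_rank g d)"
    and i: "1 \<le> s ''i''" "s ''i'' \<le> s ''n''"
    and bf: "s ''b'' + s ''n'' \<le> s ''f''"
    and inj: "inj_on M {s ''b''..<s ''b'' + s ''n''}"
    and T: "select_factor g n0 (length ds) * s ''n'' + 2 \<le> T"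
  shows "runs (grouping_select g n0 d ds) (grouping_select g n0 d ds) (s, M) T
    (\<lambda>(s', M'). ith_smallest (s ''i'') (M ` {s ''b''..<s ''b'' + s ''n''}) (M' (s' ''r'')) \<and>
      (\<forall>c < s ''b''. M' c = M c))"
  using i bf inj T
proof (induction "s ''n''" arbitrary: s M T rule: less_induct)
  case less
  let ?P = "grouping_select g n0 d ds"
  let ?W = "WHILE Equal (V ''done'') (N 0) DO select_step g n0 d ds"
  let ?K = "select_factor g n0 (length ds)"
  define b where "b = s ''b''"
  define n where "n = s ''n''"
  define f where "f = s ''f''"
  define i where "i = s ''i''"
  define S where "S = M ` {b..<b + n}"
  define Q where "Q = (\<lambda>(s' :: vname \<Rightarrow> nat, M' :: nat \<Rightarrow> 'a).
      ith_smallest i S (M' (s' ''r'')) \<and> (\<forall>c < b. M' c = M c))"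
  note IH = less.hyps[folded n_def]
  have i: "1 \<le> i" "i \<le> n" and bf: "b + n \<le> f" and inj: "inj_on M {b..<b + n}"
    and T: "?K * n + 2 \<le> T"
    using less.prems unfolding b_def n_def f_def i_def by auto
  have n1: "1 \<le> n" using i by linarith
  have finS: "finite S" and cardS: "card S = n"
    unfolding S_def using card_image[OF inj] by auto
  \<comment> \<open>Unfolds the command being run while the procedure stays folded, so the induction
    hypothesis remains applicable to calls.\<close>
  have P_eq: "runs ?P ?P \<sigma> U R \<longleftrightarrow> runs ?P (''done'' ::= N 0 ;; ?W) \<sigma> U R" for \<sigma> :: "'a state" and U R
    using grouping_select_eq[of g n0 d ds] by metis
  have exit: "runs ?P ?W (s', M') T' Q" if "s' ''done'' = 1" "4 \<le> T'" "Q (s', M')" for s' M' T'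
    using that by (subst runs_While_unfold) simp
  \<comment> \<open>With \<open>done\<close> equal to 0 the initial assignment changes nothing, so
    the rest of the loop is a fresh run on a shorter sequence. That assignment costs exactly the 2
    added to the linear bound.\<close>
  have tail: "runs ?P ?W (s2, M2) T2 Q"
    if zero: "s2 ''done'' = 0" and n2: "s2 ''n'' < n" and i2: "1 \<le> s2 ''i''" "s2 ''i'' \<le> s2 ''n''"
      and b2: "b \<le> s2 ''b''" and bf2: "s2 ''b'' + s2 ''n'' \<le> s2 ''f''"
      and inj2: "inj_on M2 {s2 ''b''..<s2 ''b'' + s2 ''n''}"
      and T2: "?K * s2 ''n'' \<le> T2"
      and frame: "\<And>c. c < b \<Longrightarrow> M2 c = M c"
      and conv: "\<And>x. ith_smallest (s2 ''i'') (M2 ` {s2 ''b''..<s2 ''b'' + s2 ''n''}) x \<Longrightarrow> ith_smallest i S x"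
    for s2 M2 T2
  proof -
    have "runs ?P ?P (s2, M2) (T2 + 2) (\<lambda>(s', M'). ith_smallest (s2 ''i'')
        (M2 ` {s2 ''b''..<s2 ''b'' + s2 ''n''}) (M' (s' ''r'')) \<and> (\<forall>c < s2 ''b''. M' c = M2 c))"
      using T2 by (intro IH n2 i2 bf2 inj2) simp
    then have "runs ?P ?P (s2, M2) (T2 + 2) Q"
      by (rule runs_mono) (use conv frame b2 in \<open>auto simp: Q_def\<close>)
    then have "runs ?P (''done'' ::= N 0 ;; ?W) (s2, M2) (T2 + 2) Q" unfolding P_eq .
    moreover have "s2(''done'' := 0) = s2" using zero by auto
    ultimately show ?thesis by simp
  qed
  \<comment> \<open>The 10 already spent are the initial assignment (2), the loop test (4) and the
    test of the length (4).\<close>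
  have base: "runs ?P ((insertion_sort (V ''b'') (V ''b'' \<oplus> V ''n'') ;;
        ''r'' ::= V ''b'' \<oplus> V ''i'' \<ominus> N 1 ;; ''done'' ::= N 1) ;; ?W) (s(''done'' := 0), M) (T - 10) Q"
    if "n \<le> n0"
    unfolding runs_Seq_assoc
  proof (rule runs_Seq[where ?T1.0 = "sort_time n0" and R = "\<lambda>(s1, M1).
      (\<forall>x. x \<notin> {''j'', ''l'', ''done''} \<longrightarrow> s1 x = s x) \<and>
      (\<forall>c. c \<notin> {b..<b + n} \<and> c \<noteq> f + n \<longrightarrow> M1 c = M c) \<and>
      M1 ` {b..<b + n} = S \<and>
      (\<forall>c d. b \<le> c \<and> c \<le> d \<and> d < b + n \<longrightarrow> M1 c \<le> M1 d)"])
    show "runs ?P (insertion_sort (V ''b'') (V ''b'' \<oplus> V ''n'')) (s(''done'' := 0), M) (sort_time n0)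
      (\<lambda>(s1, M1). (\<forall>x. x \<notin> {''j'', ''l'', ''done''} \<longrightarrow> s1 x = s x) \<and>
      (\<forall>c. c \<notin> {b..<b + n} \<and> c \<noteq> f + n \<longrightarrow> M1 c = M c) \<and>
      M1 ` {b..<b + n} = S \<and>
      (\<forall>c d. b \<le> c \<and> c \<le> d \<and> d < b + n \<longrightarrow> M1 c \<le> M1 d))"
      by (rule runs_insertion_sort[where a = b and w = n])
        (use bf sort_time_mono[OF that] in \<open>simp_all add: b_def n_def f_def S_def\<close>)
    have "?K * 1 \<le> ?K * n" using n1 by (intro mult_left_mono) auto
    moreover have "sort_time n0 + 20 \<le> ?K" unfolding select_factor_def by simp
    ultimately have T': "sort_time n0 + 20 + 2 \<le> T" using T by linarith
    then show "sort_time n0 \<le> T - 10" by linarith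
    fix \<sigma>1 :: "'a state"
    assume *: "case \<sigma>1 of (s1, M1) \<Rightarrow> (\<forall>x. x \<notin> {''j'', ''l'', ''done''} \<longrightarrow> s1 x = s x) \<and>
      (\<forall>c. c \<notin> {b..<b + n} \<and> c \<noteq> f + n \<longrightarrow> M1 c = M c) \<and>
      M1 ` {b..<b + n} = S \<and>
      (\<forall>c d. b \<le> c \<and> c \<le> d \<and> d < b + n \<longrightarrow> M1 c \<le> M1 d)"
    obtain s1 M1 where \<sigma>1: "\<sigma>1 = (s1, M1)" by fastforce
    have s1: "s1 ''b'' = b" "s1 ''i'' = i" using * unfolding \<sigma>1 b_def i_def by auto
    have out: "\<And>c. c \<notin> {b..<b + n} \<Longrightarrow> c \<noteq> f + n \<Longrightarrow> M1 c = M c"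
      and img: "M1 ` {b..<b + n} = S"
      and srt: "\<And>c d. b \<le> c \<Longrightarrow> c \<le> d \<Longrightarrow> d < b + n \<Longrightarrow> M1 c \<le> M1 d"
      using * unfolding \<sigma>1 prod.case by blast+
    have "inj_on M1 {b..<b + n}" using img cardS by (intro eq_card_imp_inj_on) auto
    from ith_smallest_sorted[OF this srt i] have "ith_smallest i S (M1 (b + i - 1))"
      unfolding img by simp
    then have "Q (s1(''r'' := b + i - 1, ''done'' := 1), M1)"
      using out bf unfolding Q_def by simp
    then have "runs ?P ?W (s1(''r'' := b + i - 1, ''done'' := 1), M1) (T - (sort_time n0 + 18)) Q"
      using T' by (intro exit) auto
    moreover obtain T\<^sub>2 where "T = sort_time n0 + 22 + T\<^sub>2" using T' le_Suc_ex by fastforce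
    ultimately show "runs ?P ((''r'' ::= V ''b'' \<oplus> V ''i'' \<ominus> N 1 ;; ''done'' ::= N 1) ;; ?W) \<sigma>1
        (T - 10 - sort_time n0) Q"
      unfolding \<sigma>1 using s1 by (simp add: eval_nat_numeral)
  qed
  \<comment> \<open>\<open>regs\<close> lists the registers that an iteration may change before the
    final case distinction. \<open>mem\<close> allows the grouping step to rearrange the current
    sequence but protects the other cells below \<open>f\<close>.\<close>
  define regs where "regs = (\<lambda>s' :: vname \<Rightarrow> nat. s' ''done'' = 0 \<and>
      (\<forall>z. z \<notin> {''p'', ''e'', ''k'', ''j'', ''l'', ''m'', ''c1'', ''c2'', ''done''} \<longrightarrow> s' z = s z))"
  define mem where "mem = (\<lambda>M' :: nat \<Rightarrow> 'a.
      (\<forall>c. c < f \<and> c \<notin> {b..<b + n} \<longrightarrow> M' c = M c) \<and> M' ` {b..<b + n} = S)"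
  let ?G = "g ^ Suc (length ds)"
  define h where "h = n div ?G"
  let ?R = "V ''i'' \<ominus> N 1"
  let ?last = "IF Equal (V ''c1'') ?R
        THEN (
          ''r'' ::= V ''f'';;
          ''done'' ::= N 1)
        ELSE (
          ''e'' ::= V ''f'' \<oplus> N 1 \<oplus> V ''n'' \<oplus> V ''n'';;
          IF Less ?R (V ''c1'')
          THEN (
            ''b'' ::= V ''f'' \<oplus> N 1;;
            ''n'' ::= V ''c1'')
          ELSE (
            ''b'' ::= V ''f'' \<oplus> N 1 \<oplus> V ''n'';;
            ''n'' ::= V ''c2'';;
            ''i'' ::= V ''i'' \<ominus> V ''c1'' \<ominus> N 1);;
          ''f'' ::= V ''e'')"
  have regsD: "s' ''b'' = b" "s' ''n'' = n" "s' ''f'' = f" "s' ''i'' = i" "s' ''done'' = 0"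
    if "regs s'" for s'
    using that unfolding regs_def b_def n_def f_def i_def by auto
  have regs_trans: "regs s2"
    if "regs s1" "\<forall>z. z \<notin> {''p'', ''e'', ''k'', ''j'', ''l''} \<longrightarrow> s2 z = s1 z" for s1 s2
    using that unfolding regs_def by simp
  have mem_inj: "inj_on M' {b..<b + n}" if "mem M'" for M'
    using that cardS unfolding mem_def by (intro eq_card_imp_inj_on) auto
  \<comment> \<open>The longest branch costs 36, and the branch returning the pivot costs 10 plus 4
    for leaving the loop; 50 covers them all.\<close>
  have last: "runs ?P (?last ;; ?W) (s5, M5) T6 Q"
    if regs: "regs s5" and frame: "\<And>c. c < b \<Longrightarrow> M5 c = M c"
      and vS: "v \<in> S" and v: "M5 f = v"
      and c1: "s5 ''c1'' = card {y \<in> S. y < v}" and c2: "s5 ''c2'' = card {y \<in> S. v < y}"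
      and img1: "M5 ` {f + 1..<f + 1 + s5 ''c1''} = {y \<in> S. y < v}"
      and img2: "M5 ` {f + 1 + n..<f + 1 + n + s5 ''c2''} = {y \<in> S. v < y}"
      and T1: "?K * s5 ''c1'' + 50 \<le> T6" and T2: "?K * s5 ''c2'' + 50 \<le> T6"
    for s5 M5 v T6
  proof -
    note s5 = regsD[OF regs]
    \<comment> \<open>The pivot belongs to neither side. Hence both sides are shorter than
      \<open>n\<close>, and both output areas end before the new free address
      \<open>f + 1 + n + n\<close>.\<close>
    have sum: "s5 ''c1'' + s5 ''c2'' + 1 = n"
      using card_split_at(1)[OF vS finS] cardS unfolding c1 c2 by simp
    have "card (M5 ` {f + 1..<f + 1 + s5 ''c1''}) = s5 ''c1''"
      and "card (M5 ` {f + 1 + n..<f + 1 + n + s5 ''c2''}) = s5 ''c2''"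
      unfolding img1 img2 by (rule c1[symmetric], rule c2[symmetric])
    then have inj1: "inj_on M5 {f + 1..<f + 1 + s5 ''c1''}"
      and inj2: "inj_on M5 {f + 1 + n..<f + 1 + n + s5 ''c2''}"
      by (auto intro!: eq_card_imp_inj_on)
    consider "s5 ''c1'' = i - 1" | "i - 1 < s5 ''c1''" | "s5 ''c1'' < i - 1" by linarith
    then show ?thesis
    proof cases
      case 1
      then have "Q (s5(''r'' := f, ''done'' := 1), M5)"
        using vS v c1 i frame unfolding Q_def ith_smallest_def by simp
      then have "runs ?P ?W (s5(''r'' := f, ''done'' := 1), M5) (T6 - 10) Q"
        using T1 by (intro exit) auto
      moreover obtain T7 where "T6 = 10 + T7" using T1 le_Suc_ex[of 10 T6] by auto
      ultimately show ?thesis using 1 s5 by (simp add: eval_nat_numeral)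
    next
      case 2
      let ?s = "s5(''e'' := f + 1 + n + n, ''b'' := f + 1, ''n'' := s5 ''c1'', ''f'' := f + 1 + n + n)"
      have "runs ?P ?W (?s, M5) (T6 - 28) Q"
      proof (rule tail)
        show "inj_on M5 {?s ''b''..<?s ''b'' + ?s ''n''}"
          using inj1 by simp
        show "ith_smallest i S x" if "ith_smallest (?s ''i'') (M5 ` {?s ''b''..<?s ''b'' + ?s ''n''}) x" for x
          by (rule ith_smallest_below[where v = v]) (use that s5 img1 in simp)
      qed (use 2 s5 sum i bf T1 frame in auto)
      moreover obtain T7 where "T6 = 28 + T7" using T1 le_Suc_ex[of 28 T6] by auto
      ultimately show ?thesis using 2 s5 by (simp add: eval_nat_numeral)
    next
      case 3
      let ?s = "s5(''e'' := f + 1 + n + n, ''b'' := f + 1 + n, ''n'' := s5 ''c2'',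
          ''i'' := i - s5 ''c1'' - 1, ''f'' := f + 1 + n + n)"
      have "runs ?P ?W (?s, M5) (T6 - 36) Q"
      proof (rule tail)
        show "inj_on M5 {?s ''b''..<?s ''b'' + ?s ''n''}"
          using inj2 by simp
        show "ith_smallest i S x" if x: "ith_smallest (?s ''i'') (M5 ` {?s ''b''..<?s ''b'' + ?s ''n''}) x" for x
        proof -
          have "ith_smallest (i - s5 ''c1'' - 1) {y \<in> S. v < y} x" using x img2 by simp
          from ith_smallest_above[OF this vS finS] show ?thesis using 3 unfolding c1 by simp
        qed
      qed (use 3 s5 sum i bf T2 frame in auto)
      moreover obtain T7 where "T6 = 36 + T7" using T1 le_Suc_ex[of 36 T6] by auto
      ultimately show ?thesis using 3 s5 by (simp add: eval_nat_numeral)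
    qed
  qed
  let ?Gt = "group_time g n"
  have rec: "runs ?P ((group_medians g d (V ''b'') (V ''n'') ;;
        repeat_grouping g ds ;;
        Call ''m'' [(''b'', V ''f''), (''n'', V ''k''), (''i'', Half (V ''k'' \<oplus> N 1)),
                    (''f'', V ''f'' \<oplus> V ''k'')] ;;
        Move (V ''f'') (V ''m'') ;;
        partition_sequence ;;
        ?last) ;; ?W) (s(''done'' := 0), M) (T - 10) Q"
    if nn: "n0 < n"
  proof -
    have "g ^ Suc (length ds) \<le> n" using nn n0 by linarith
    note recurrence = select_factor_recurrence[OF _ this h_def]
    have "2 * 1 \<le> ?G" using g by (simp only: power_Suc) (intro mult_mono, auto)
    then have "h < n" "1 \<le> h"
      using g n1 \<open>g ^ Suc (length ds) \<le> n\<close> unfolding h_def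
      by (auto intro: div_less_dividend simp: Suc_le_eq div_greater_zero_iff)
    \<comment> \<open>Additive costs are 1 after the repeated grouping, 16 for the call (13 for
      arguments, 1 for the call itself, 2 from the bound of the callee), 3 for moving the pivot and
      14 in the partition. With 60 in reserve they fit into the 100 of the recurrence.\<close>
    have budget: "?Gt + (length ds * ?Gt + 1) + (?K * h + 16) + 3 + (29 * n + 14) + ?K * n' + 60 \<le> T - 10 + 2"
      if "2 * n' + 3 * h \<le> 2 * n" for n'
    proof -
      have "Suc (length ds) * ?Gt = ?Gt + length ds * ?Gt" by simp
      moreover have "0 < g" using g by simp
      ultimately show ?thesis using recurrence[OF _ that, of n0] T by linarith
    qed
    let ?lo = "\<Prod>d\<leftarrow>d # ds. median_rank g d" and ?hi = "\<Prod>d\<leftarrow>d # ds. g + 1 - median_rank g d"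
    let ?T1 = "T - 10 - ?Gt"
    let ?T2 = "?T1 - (length ds * ?Gt + 1)"
    let ?T3 = "?T2 - (?K * h + 16)"
    let ?T4 = "?T3 - 3"
    let ?T5 = "?T4 - (29 * n + 14)"
    have T5: "?K * n' + 50 \<le> ?T5" and T0: "?Gt + (length ds * ?Gt + 1) + (?K * h + 16) + 3 + (29 * n + 14) \<le> T - 10"
      if "2 * n' + 3 * h \<le> 2 * n" for n'
      using budget[OF that] by linarith+
    \<comment> \<open>At least halving the length makes \<open>n' = 0\<close> admissible in
      \<open>T0\<close>, which yields the budget of the common prefix before the side to continue on
      is known.\<close>
    have "h * 2 \<le> h * ?G" using \<open>2 * 1 \<le> ?G\<close> by (intro mult_left_mono) auto
    moreover have "h * ?G \<le> n" unfolding h_def by (rule div_times_less_eq_dividend)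
    ultimately have h3: "3 * h \<le> 2 * n" by linarith
    have T0: "?Gt + (length ds * ?Gt + 1) + (?K * h + 16) + 3 + (29 * n + 14) \<le> T - 10"
      using T0[of 0] h3 by simp
    have part: "runs ?P ((partition_sequence ;; ?last) ;; ?W) (s4, M4) ?T4 Q"
      if regs: "regs s4" and mem: "mem M4" and vS: "M4 f \<in> S"
        and small: "2 * card {y \<in> S. y < M4 f} + 3 * h \<le> 2 * n" "2 * card {y \<in> S. M4 f < y} + 3 * h \<le> 2 * n"
      for s4 M4
      unfolding runs_Seq_assoc
    proof (rule runs_Seq[where ?T1.0 = "29 * n + 14" and R = "\<lambda>(s5, M5).
        (\<forall>z. z \<notin> {''p'', ''e'', ''c1'', ''c2''} \<longrightarrow> s5 z = s4 z) \<and>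
        s5 ''c1'' = card {y \<in> S. y < M4 f} \<and> s5 ''c2'' = card {y \<in> S. M4 f < y} \<and>
        M5 ` {f + 1..<f + 1 + s5 ''c1''} = {y \<in> S. y < M4 f} \<and>
        M5 ` {f + 1 + n..<f + 1 + n + s5 ''c2''} = {y \<in> S. M4 f < y} \<and>
        (\<forall>c \<le> f. M5 c = M4 c)"])
      have "M4 ` {b..<b + n} = S" using mem unfolding mem_def by blast
      then show "runs ?P partition_sequence (s4, M4) (29 * n + 14) (\<lambda>(s5, M5).
        (\<forall>z. z \<notin> {''p'', ''e'', ''c1'', ''c2''} \<longrightarrow> s5 z = s4 z) \<and>
        s5 ''c1'' = card {y \<in> S. y < M4 f} \<and> s5 ''c2'' = card {y \<in> S. M4 f < y} \<and>
        M5 ` {f + 1..<f + 1 + s5 ''c1''} = {y \<in> S. y < M4 f} \<and>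
        M5 ` {f + 1 + n..<f + 1 + n + s5 ''c2''} = {y \<in> S. M4 f < y} \<and>
        (\<forall>c \<le> f. M5 c = M4 c))"
        using bf mem_inj[OF mem] by (intro runs_partition) (simp_all add: regsD[OF regs])
      show "29 * n + 14 \<le> ?T4" using T0 by linarith
      fix \<sigma>5 :: "'a state"
      assume *: "case \<sigma>5 of (s5, M5) \<Rightarrow>
        (\<forall>z. z \<notin> {''p'', ''e'', ''c1'', ''c2''} \<longrightarrow> s5 z = s4 z) \<and>
        s5 ''c1'' = card {y \<in> S. y < M4 f} \<and> s5 ''c2'' = card {y \<in> S. M4 f < y} \<and>
        M5 ` {f + 1..<f + 1 + s5 ''c1''} = {y \<in> S. y < M4 f} \<and>
        M5 ` {f + 1 + n..<f + 1 + n + s5 ''c2''} = {y \<in> S. M4 f < y} \<and>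
        (\<forall>c \<le> f. M5 c = M4 c)"
      obtain s5 M5 where \<sigma>5: "\<sigma>5 = (s5, M5)" by fastforce
      note * = *[unfolded \<sigma>5 prod.case]
      have c12: "s5 ''c1'' = card {y \<in> S. y < M4 f}" "s5 ''c2'' = card {y \<in> S. M4 f < y}"
        and imgs: "M5 ` {f + 1..<f + 1 + s5 ''c1''} = {y \<in> S. y < M4 f}"
          "M5 ` {f + 1 + n..<f + 1 + n + s5 ''c2''} = {y \<in> S. M4 f < y}"
        and same: "\<forall>c \<le> f. M5 c = M4 c"
        using * by blast+
      show "runs ?P (?last ;; ?W) \<sigma>5 ?T5 Q"
        unfolding \<sigma>5
      proof (rule last[where v = "M4 f"])
        show "regs s5" using * regs unfolding regs_def by simp
        show "M5 c = M c" if "c < b" for c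
        proof -
          have "c < f" "c \<notin> {b..<b + n}" using that bf by auto
          then show ?thesis using same mem unfolding mem_def by simp
        qed
      qed (use vS same c12 imgs small T5 in auto)
    qed
    \<comment> \<open>The callee may rearrange the medians and use all cells beyond them, but its
      frame condition spares those below \<open>f\<close>, where the current sequence lies. Moving
      the pivot to \<open>f\<close> therefore destroys only a median that has served its
      purpose.\<close>
    have call: "runs ?P ((Call ''m'' [(''b'', V ''f''), (''n'', V ''k''), (''i'', Half (V ''k'' \<oplus> N 1)),
                    (''f'', V ''f'' \<oplus> V ''k'')] ;;
        Move (V ''f'') (V ''m'') ;;
        partition_sequence ;;
        ?last) ;; ?W) (s2, M2) ?T2 Q"
      if regs: "regs s2" and mem: "mem M2" and k: "s2 ''k'' = h" and rep: "represents M2 f h S ?lo ?hi"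
      for s2 M2
      unfolding runs_Seq_assoc
    proof (rule runs_Seq[where ?T1.0 = "?K * h + 16" and R = "\<lambda>(s3, M3).
        (\<forall>z. z \<noteq> ''m'' \<longrightarrow> s3 z = s2 z) \<and>
        ith_smallest ((h + 1) div 2) (M2 ` {f..<f + h}) (M3 (s3 ''m'')) \<and> (\<forall>c < f. M3 c = M2 c)"])
      define s0 where "s0 = frame [(''b'', f), (''n'', h), (''i'', (h + 1) div 2), (''f'', f + h)]"
      have fr: "s0 ''b'' = f" "s0 ''n'' = h" "s0 ''i'' = (h + 1) div 2" "s0 ''f'' = f + h"
        unfolding s0_def frame_def by simp_all
      have "runs ?P ?P (s0, M2) (?K * h + 2)
        (\<lambda>(s', M'). ith_smallest (s0 ''i'') (M2 ` {s0 ''b''..<s0 ''b'' + s0 ''n''}) (M' (s' ''r'')) \<and>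
          (\<forall>c < s0 ''b''. M' c = M2 c))"
        using \<open>h < n\<close> \<open>1 \<le> h\<close> represents_inj_on[OF rep] by (intro IH) (simp_all add: fr)
      then have "runs ?P ?P (s0, M2) (?K * h + 2)
        (\<lambda>(s', M'). ith_smallest ((h + 1) div 2) (M2 ` {f..<f + h}) (M' (s' ''r'')) \<and> (\<forall>c < f. M' c = M2 c))"
        unfolding fr .
      then show "runs ?P (Call ''m'' [(''b'', V ''f''), (''n'', V ''k''), (''i'', Half (V ''k'' \<oplus> N 1)),
                    (''f'', V ''f'' \<oplus> V ''k'')]) (s2, M2) (?K * h + 16) (\<lambda>(s3, M3).
        (\<forall>z. z \<noteq> ''m'' \<longrightarrow> s3 z = s2 z) \<and>
        ith_smallest ((h + 1) div 2) (M2 ` {f..<f + h}) (M3 (s3 ''m'')) \<and> (\<forall>c < f. M3 c = M2 c))"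
        by (intro runs_Call[where ?T1.0 = "?K * h + 2"])
          (simp_all add: s0_def k regsD[OF regs] split_beta)
      show "?K * h + 16 \<le> ?T2" using T0 by linarith
      fix \<sigma>3 :: "'a state"
      assume *: "case \<sigma>3 of (s3, M3) \<Rightarrow> (\<forall>z. z \<noteq> ''m'' \<longrightarrow> s3 z = s2 z) \<and>
        ith_smallest ((h + 1) div 2) (M2 ` {f..<f + h}) (M3 (s3 ''m'')) \<and> (\<forall>c < f. M3 c = M2 c)"
      obtain s3 M3 where \<sigma>3: "\<sigma>3 = (s3, M3)" by fastforce
      note * = *[unfolded \<sigma>3 prod.case]
      define v where "v = M3 (s3 ''m'')"
      have med: "ith_smallest ((h + 1) div 2) (M2 ` {f..<f + h}) v" using * unfolding v_def by blast
      note small = median_of_representatives[OF rep finS lo hi med, unfolded cardS]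
      have "regs s3" using * regs unfolding regs_def by simp
      moreover have "mem (M3(f := v))"
      proof -
        have "(M3(f := v)) c = M2 c" if "c < f" for c using * that by simp
        moreover have "(M3(f := v)) ` {b..<b + n} = M2 ` {b..<b + n}"
          using bf * by (intro image_cong) auto
        ultimately show ?thesis using mem unfolding mem_def by simp
      qed
      ultimately have "runs ?P ((partition_sequence ;; ?last) ;; ?W) (s3, M3(f := v)) ?T4 Q"
        using small by (intro part) simp_all
      moreover have "3 \<le> ?T3" using T0 by linarith
      ultimately show "runs ?P ((Move (V ''f'') (V ''m'') ;; partition_sequence ;; ?last) ;; ?W) \<sigma>3 ?T3 Q"
        unfolding \<sigma>3 runs_Seq_assoc runs_Move_Seq using regsD[OF \<open>regs s3\<close>] by (simp add: v_def eval_nat_numeral)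
    qed
    have rep: "runs ?P ((repeat_grouping g ds ;;
        Call ''m'' [(''b'', V ''f''), (''n'', V ''k''), (''i'', Half (V ''k'' \<oplus> N 1)),
                    (''f'', V ''f'' \<oplus> V ''k'')] ;;
        Move (V ''f'') (V ''m'') ;;
        partition_sequence ;;
        ?last) ;; ?W) (s1, M1) ?T1 Q"
      if regs: "regs s1" and mem: "mem M1" and k: "s1 ''k'' = n div g"
        and rep: "represents M1 f (n div g) S (median_rank g d * 1) ((g + 1 - median_rank g d) * 1)"
      for s1 M1
      unfolding runs_Seq_assoc
    proof (rule runs_Seq[where ?T1.0 = "length ds * ?Gt + 1" and R = "\<lambda>(s2, M2).
        regs s2 \<and> mem M2 \<and> s2 ''k'' = h \<and> represents M2 f h S ?lo ?hi"])
      have h: "n div g div g ^ length ds = h" unfolding h_def by (simp add: div_mult2_eq)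
      have "mem M2" if "\<forall>c < f. M2 c = M1 c" for M2
      proof -
        have "M2 ` {b..<b + n} = M1 ` {b..<b + n}"
          using bf that by (intro image_cong) auto
        then show ?thesis using mem that unfolding mem_def by simp
      qed
      then show "runs ?P (repeat_grouping g ds) (s1, M1) (length ds * ?Gt + 1) (\<lambda>(s2, M2).
        regs s2 \<and> mem M2 \<and> s2 ''k'' = h \<and> represents M2 f h S ?lo ?hi)"
        using rep finS g regs_trans[OF regs]
        by (intro runs_repeat_grouping[where S = S and lo = "median_rank g d * 1"
              and hi = "(g + 1 - median_rank g d) * 1"])
          (simp_all add: regsD[OF regs] k h mult.commute del: median_rank.simps)
      show "length ds * ?Gt + 1 \<le> ?T1" using T0 by linarith
    qed (use call in auto)
    show ?thesis
      unfolding runs_Seq_assoc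
    proof (rule runs_Seq[where ?T1.0 = ?Gt and R = "\<lambda>(s1, M1). regs s1 \<and> mem M1 \<and> s1 ''k'' = n div g \<and>
        represents M1 f (n div g) S (median_rank g d * 1) ((g + 1 - median_rank g d) * 1)"])
      have "regs (s(''done'' := 0))" unfolding regs_def by simp
      note regs = regsD[OF this] regs_trans[OF this]
      show "runs ?P (group_medians g d (V ''b'') (V ''n'')) (s(''done'' := 0), M) ?Gt
        (\<lambda>(s1, M1). regs s1 \<and> mem M1 \<and> s1 ''k'' = n div g \<and>
        represents M1 f (n div g) S (median_rank g d * 1) ((g + 1 - median_rank g d) * 1))"
      \<comment> \<open>Before any grouping, each element represents the singleton block consisting
        of itself.\<close>
      proof (rule runs_group_medians[where S = S and lo = 1 and hi = 1])
        show "represents M ((s(''done'' := 0)) ''b'') ((s(''done'' := 0)) ''n'') S 1 1"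
          using represents_singletons[OF inj] unfolding regs S_def .
      next
        fix s1 and M1 :: "nat \<Rightarrow> 'a"
        assume 1: "\<forall>z. z \<notin> {''p'', ''e'', ''k'', ''j'', ''l''} \<longrightarrow> s1 z = (s(''done'' := 0)) z"
          and 2: "s1 ''k'' = (s(''done'' := 0)) ''n'' div g"
            "represents M1 ((s(''done'' := 0)) ''f'') ((s(''done'' := 0)) ''n'' div g) S
              (median_rank g d * 1) ((g + 1 - median_rank g d) * 1)"
          and 3: "\<forall>c. c < (s(''done'' := 0)) ''f'' \<and> c \<notin> {(s(''done'' := 0)) ''b''..<(s(''done'' := 0)) ''b'' + (s(''done'' := 0)) ''n''} \<longrightarrow> M1 c = M c"
            "(s(''done'' := 0)) ''b'' + (s(''done'' := 0)) ''n'' \<le> (s(''done'' := 0)) ''f'' \<longrightarrow>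
              M1 ` {(s(''done'' := 0)) ''b''..<(s(''done'' := 0)) ''b'' + (s(''done'' := 0)) ''n''} =
              M ` {(s(''done'' := 0)) ''b''..<(s(''done'' := 0)) ''b'' + (s(''done'' := 0)) ''n''}"
        have "mem M1" using 3 bf unfolding regs mem_def S_def by blast
        then show "case (s1, M1) of (s1, M1) \<Rightarrow> regs s1 \<and> mem M1 \<and> s1 ''k'' = n div g \<and>
          represents M1 f (n div g) S (median_rank g d * 1) ((g + 1 - median_rank g d) * 1)"
          using regs(6)[OF 1] 2 unfolding regs prod.case by blast
      qed (use g bf finS in \<open>simp_all add: regs(1-5)[simplified]\<close>)
      show "?Gt \<le> T - 10" using T0 by linarith
    qed (use rep in auto)
  qed
  have "?K * 1 \<le> ?K * n" using n1 by (intro mult_left_mono) auto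
  moreover have "20 \<le> ?K" unfolding select_factor_def by simp
  ultimately have "10 \<le> T" using T by linarith
  then obtain T' where T': "T = 10 + T'" using le_Suc_ex by blast
  have "runs ?P (''done'' ::= N 0 ;; ?W) (s, M) T Q"
  proof (cases "n \<le> n0")
    case True
    then show ?thesis using base[OF True]
      by (simp add: T' runs_While_unfold[of _ _ _ "(s(''done'' := 0), M)"] select_step_def eval_nat_numeral n_def)
  next
    case False
    then show ?thesis using rec
      by (simp add: T' runs_While_unfold[of _ _ _ "(s(''done'' := 0), M)"] select_step_def eval_nat_numeral n_def)
  qed
  then show ?case unfolding P_eq Q_def i_def S_def b_def n_def .
qed

text \<open>The run delivers an element of the right rank in \<open>set A\<close>; uniqueness of
  that element identifies it with the entry of the sorted list. The products are the block bounds
  after all grouping steps.\<close>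

theorem grouping_select_solves_selection:
  assumes "2 \<le> g" "g ^ Suc (length ds) \<le> n0"
    and "3 \<le> (\<Prod>d\<leftarrow>d # ds. median_rank g d)" "3 \<le> (\<Prod>d\<leftarrow>d # ds. g + 1 - median_rank g d)"
  shows "solves_selection_in_time (grouping_select g n0 d ds)
    (\<lambda>n. select_factor g n0 (length ds) * n + 2)"
  unfolding solves_selection_in_time_def
proof (intro allI impI)
  fix A :: "real list" and i and M :: "nat \<Rightarrow> real"
  assume A: "distinct A" "1 \<le> i" "i \<le> length A" "\<forall>j < length A. M j = A ! j"
  let ?P = "grouping_select g n0 d ds"
  define s where "s = frame [(''b'', 0), (''n'', length A), (''i'', i), (''f'', length A)]"
  have s: "s ''b'' = 0" "s ''n'' = length A" "s ''i'' = i" "s ''f'' = length A"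
    unfolding s_def frame_def by simp_all
  have img: "M ` {0..<0 + length A} = set A"
    using A(4) by (auto simp: set_conv_nth image_def)
  have "inj_on M {0..<0 + length A}"
    using A(1,4) by (auto simp: inj_on_def nth_eq_iff_index_eq)
  then have "runs ?P ?P (s, M) (select_factor g n0 (length ds) * length A + 2)
      (\<lambda>(s', M'). ith_smallest i (set A) (M' (s' ''r'')) \<and> (\<forall>c < 0. M' c = M c))"
    using runs_grouping_select[OF assms, of s M] A(2,3) unfolding s img by simp
  then obtain t s' M' where "?P \<turnstile> (?P, (s, M)) \<Rightarrow>[t] (s', M')"
      "t \<le> select_factor g n0 (length ds) * length A + 2" "ith_smallest i (set A) (M' (s' ''r''))"
    unfolding runs_def by auto
  moreover from this have "M' (s' ''r'') = sort A ! (i - 1)"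
    using ith_smallest_unique[OF _ ith_smallest_sort_nth[OF A(1-3)]] by simp
  ultimately show "\<exists>t s' M'.
      ?P \<turnstile> (?P, (frame [(''b'', 0), (''n'', length A), (''i'', i), (''f'', length A)], M)) \<Rightarrow>[t] (s', M')
      \<and> M' (s' ''r'') = sort A ! (i - 1)
      \<and> t \<le> select_factor g n0 (length ds) * length A + 2"
    unfolding s_def by blast
qed

theorem theorem1:
  fixes g :: nat
  assumes "g \<in> {3, 4}"
  shows "\<exists>P T. grouping_and_partition_algorithm g P \<and> solves_selection_in_time P T \<and>
    (\<lambda>n. real (T n)) \<in> O(\<lambda>n. real n)"
proof -
  have linear: "(\<lambda>n. real (K * n + 2)) \<in> O(\<lambda>n. real n)" for K
  proof (rule bigoI[where c = "real K + 2"])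
    show "\<forall>\<^sub>F n in sequentially. norm (real (K * n + 2)) \<le> (real K + 2) * norm (real n)"
      using eventually_ge_at_top[of 1] by eventually_elim (simp add: algebra_simps)
  qed
  \<comment> \<open>For \<open>g = 3\<close> both kinds of median coincide. The cutoff 16 used next
    is the larger of the two values of \<open>g ^ 2\<close>, so the bound on \<open>n0\<close> holds
    for both group sizes.\<close>
  define d where "d = (if g = 3 then Lower else Upper)"
  have "solves_selection_in_time (grouping_select g 16 Lower [d])
      (\<lambda>n. select_factor g 16 (length [d]) * n + 2)"
    using assms by (intro grouping_select_solves_selection) (auto simp: d_def)
  then show ?thesis
    using linear unfolding grouping_and_partition_algorithm_def by blast
qed

end
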